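(* In the setting of the convex problem $\inf_{x\in X} f(x)$ subject to $C(x)\in K$ described in the context, let $(x^k,y^k,\lambda^k,s^k)_{k}$ be a sequence generated by the inexact augmented Lagrangian method (IALM) with errors $(\varepsilon_k)_{k\ge1}$ and penalty parameters $(\gamma_k)_{k\ge0}$ satisfying the error and step-size conditions. Then: (a) $C(x^k)-y^k\to\bar s$; (b) $\|y^k-\operatorname{Proj}_K(C(x^k))\|\to0$; (c) $f(x^k)\to h^*(\bar s)$ in $\mathbb{R}\cup\{+\infty\}$. Furthermore, if $h^*(\bar s)<\infty$, then as $k\to\infty$: (d) $\|C(x^k)-y^k-\bar s\|=O\left(\frac{1}{\sqrt{\sum_{i=0}^{k-1}\gamma_i}}\right)$; (e) $\|y^k-\operatorname{Proj}_K(C(x^k))\|=O\left(\frac{1}{\sqrt{\sum_{i=0}^{k-1}\gamma_i}}\right)$.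
   Context: Setting. $X$ is a nonempty closed convex subset of a real Hilbert space, $Y$ is a real Hilbert space, $K\subseteq Y$ is nonempty, closed and convex, $f:X\to\mathbb{R}\cup\{+\infty\}$ is closed (lower semicontinuous), proper and convex, and $C:X\to Y$ is a mapping such that $\mathcal{C}=\{(x,s)\in X\times Y: s\in C(x)-K\}$ is closed and convex. The problem may be infeasible. The value function is $\nu(s)=\inf\{f(x): x\in X,\ C(x)\in K+s\}$ for $s\in Y$; it is assumed throughout that $\nu(s)>-\infty$ for all $s$. The negative dual function is $h(\lambda)=\sup_{(x,s)\in\mathcal{C}}\left(\langle\lambda,s\rangle-f(x)\right)$ and $h^*(s)=\sup_{\lambda\in Y}\langle s,\lambda\rangle-h(\lambda)$. The set of attainable constraint violations is $\mathcal{S}=\{s\in Y:\exists x\in X,\ f(x)<\infty,\ (x,s)\in\mathcal{C}\}$ (convex), and $\bar s=\operatorname{argmin}_{s\in\operatorname{cl}(\mathcal{S})}\|s\|$. $\operatorname{Proj}_K$ is the metric projection onto $K$. IALM. For $\gamma>0$ and $(x,s)\in\mathcal{C}$ let $L_\gamma(x,s,\lambda)=f(x)-\langle\lambda,s\rangle+\tfrac{\gamma}{2}\|s\|^2$. Given $\lambda^0\in Y$, $\gamma_k>0$, $\varepsilon_k\ge0$, for $k=0,1,2,\dots$: find $x^{k+1}\in X$, $y^{k+1}\in K$ such that, with $s^{k+1}=C(x^{k+1})-y^{k+1}$, $L_{\gamma_k}(x^{k+1},s^{k+1},\lambda^k)-\inf_{(x,s)\in\mathcal{C}}L_{\gamma_k}(x,s,\lambda^k)\le\frac{(\varepsilon_{k+1})^2}{2\gamma_k}$;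 set $\lambda^{k+1}=\lambda^k-\gamma_ks^{k+1}$. Error and step-size conditions: $\gamma_k>0$, $\varepsilon_k\ge 0$, and (A1) $\sum_{k=1}^\infty\varepsilon_k<\infty$; (A2) $\frac{\varepsilon_{k+1}}{\gamma_k}\sum_{i=0}^k\gamma_i=O\left(\frac{1}{\sqrt{\sum_{i=0}^k\gamma_i}}\right)$; (A3) $\sum_{k=1}^\infty\left((\varepsilon_k/\gamma_k)^2\sum_{i=0}^{k-1}\gamma_i\right)<\infty$; (A4) $\sum_{k=1}^\infty\left((\varepsilon_k/\gamma_k)\sum_{i=1}^{k}\gamma_{i-1}\right)<\infty$; (A5) $\sum_{k=0}^\infty\gamma_k=\infty$. *)

theory Defs
  imports "HOL-Analysis.Analysis" "HOL-Library.Landau_Symbols"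
begin

text \<open>
  A real Hilbert space is a type of sort \<open>{real_inner, complete_space}\<close>. Maps defined on a
  subset \<open>X\<close> are total functions of which only the values on \<open>X\<close> are used. Functions into
  the reals extended by \<open>\<infinity>\<close> take values in \<^typ>\<open>ereal\<close>, and the value \<open>-\<infinity>\<close>
  is excluded by \<open>proper_on\<close>.
\<close>

definition proper_on :: "'a set \<Rightarrow> ('a \<Rightarrow> ereal) \<Rightarrow> bool" where
  "proper_on X f \<longleftrightarrow> (\<forall>x\<in>X. f x \<noteq> -\<infinity>) \<and> (\<exists>x\<in>X. f x < \<infinity>)"

text \<open>At a point isolated in \<open>X\<close> the lower limit is \<open>\<infinity>\<close>, so nothing is required there.\<close>

definition lower_semicontinuous_on :: "'a::topological_space set \<Rightarrow> ('a \<Rightarrow> ereal) \<Rightarrow> bool" where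
  "lower_semicontinuous_on X f \<longleftrightarrow> (\<forall>x\<in>X. f x \<le> Liminf (at x within X) f)"

text \<open>In \<^typ>\<open>ereal\<close>, \<open>0 * \<infinity> = 0\<close>, so the endpoints \<open>t = 0\<close> and \<open>t = 1\<close> are harmless.\<close>

definition ereal_convex_on :: "'a::real_vector set \<Rightarrow> ('a \<Rightarrow> ereal) \<Rightarrow> bool" where
  "ereal_convex_on X f \<longleftrightarrow>
     (\<forall>x\<in>X. \<forall>y\<in>X. \<forall>t\<in>{0..1::real}.
        f ((1 - t) *\<^sub>R x + t *\<^sub>R y) \<le> ereal (1 - t) * f x + ereal t * f y)"

definition metric_proj :: "'a::metric_space set \<Rightarrow> 'a \<Rightarrow> 'a" where
  "metric_proj K u = arg_min_on (\<lambda>z. dist u z) K"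

definition violation_graph :: "'a set \<Rightarrow> 'b::real_vector set \<Rightarrow> ('a \<Rightarrow> 'b) \<Rightarrow> ('a \<times> 'b) set" where
  "violation_graph X K C = {(x, s). x \<in> X \<and> s \<in> (\<lambda>y. C x - y) ` K}"

definition value_fun :: "'a set \<Rightarrow> 'b::real_vector set \<Rightarrow> ('a \<Rightarrow> 'b) \<Rightarrow> ('a \<Rightarrow> ereal) \<Rightarrow> 'b \<Rightarrow> ereal" where
  "value_fun X K C f s = (INF x\<in>{x \<in> X. C x \<in> (\<lambda>y. y + s) ` K}. f x)"

definition neg_dual ::
  "'a set \<Rightarrow> 'b::real_inner set \<Rightarrow> ('a \<Rightarrow> 'b) \<Rightarrow> ('a \<Rightarrow> ereal) \<Rightarrow> 'b \<Rightarrow> ereal" where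
  "neg_dual X K C f l = (SUP (x, s)\<in>violation_graph X K C. ereal (l \<bullet> s) - f x)"

definition conjugate :: "('b::real_inner \<Rightarrow> ereal) \<Rightarrow> 'b \<Rightarrow> ereal" where
  "conjugate h s = (SUP l. ereal (s \<bullet> l) - h l)"

definition attainable_violations ::
  "'a set \<Rightarrow> 'b::real_vector set \<Rightarrow> ('a \<Rightarrow> 'b) \<Rightarrow> ('a \<Rightarrow> ereal) \<Rightarrow> 'b set" where
  "attainable_violations X K C f = {s. \<exists>x\<in>X. f x < \<infinity> \<and> (x, s) \<in> violation_graph X K C}"

definition minimal_violation ::
  "'a set \<Rightarrow> 'b::real_normed_vector set \<Rightarrow> ('a \<Rightarrow> 'b) \<Rightarrow> ('a \<Rightarrow> ereal) \<Rightarrow> 'b" where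
  "minimal_violation X K C f = arg_min_on norm (closure (attainable_violations X K C f))"

definition aug_lagrangian ::
  "('a \<Rightarrow> ereal) \<Rightarrow> real \<Rightarrow> 'a \<Rightarrow> 'b::real_inner \<Rightarrow> 'b \<Rightarrow> ereal" where
  "aug_lagrangian f \<gamma> x s l = f x - ereal (l \<bullet> s) + ereal (\<gamma> / 2 * (norm s)\<^sup>2)"

text \<open>
  The entries \<open>x 0\<close>, \<open>y 0\<close>, \<open>s 0\<close> and \<open>\<epsilon> 0\<close> play no role. The optimality gap is taken in
  \<^typ>\<open>ereal\<close>, where \<open>\<infinity> - \<infinity> = \<infinity>\<close>; so the inequality forces both the value of the augmented
  Lagrangian at the iterate and its infimum to be finite (the value is never \<open>-\<infinity>\<close>).
\<close>

definition ialm ::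
  "'a set \<Rightarrow> 'b::real_inner set \<Rightarrow> ('a \<Rightarrow> 'b) \<Rightarrow> ('a \<Rightarrow> ereal) \<Rightarrow> (nat \<Rightarrow> real) \<Rightarrow> (nat \<Rightarrow> real) \<Rightarrow>
    (nat \<Rightarrow> 'a) \<Rightarrow> (nat \<Rightarrow> 'b) \<Rightarrow> (nat \<Rightarrow> 'b) \<Rightarrow> (nat \<Rightarrow> 'b) \<Rightarrow> bool" where
  "ialm X K C f \<gamma> \<epsilon> x y l s \<longleftrightarrow>
     (\<forall>k. x (Suc k) \<in> X \<and> y (Suc k) \<in> K \<and> s (Suc k) = C (x (Suc k)) - y (Suc k) \<and>
        aug_lagrangian f (\<gamma> k) (x (Suc k)) (s (Suc k)) (l k)
          - (INF (u, t)\<in>violation_graph X K C. aug_lagrangian f (\<gamma> k) u t (l k))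
          \<le> ereal ((\<epsilon> (Suc k))\<^sup>2 / (2 * \<gamma> k)) \<and>
        l (Suc k) = l k - \<gamma> k *\<^sub>R s (Suc k))"

text \<open>
  The series that start at index 1 are shifted by one, as \<^const>\<open>summable\<close> starts at index 0.
\<close>

definition error_step_conditions :: "(nat \<Rightarrow> real) \<Rightarrow> (nat \<Rightarrow> real) \<Rightarrow> bool" where
  "error_step_conditions \<gamma> \<epsilon> \<longleftrightarrow>
     (\<forall>k. \<gamma> k > 0) \<and> (\<forall>k\<ge>1. \<epsilon> k \<ge> 0) \<and>
     summable (\<lambda>k. \<epsilon> (Suc k)) \<and>
     (\<lambda>k. \<epsilon> (Suc k) / \<gamma> k * (\<Sum>i\<le>k. \<gamma> i)) \<in> O(\<lambda>k. 1 / sqrt (\<Sum>i\<le>k. \<gamma> i)) \<and>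
     summable (\<lambda>k. (\<epsilon> (Suc k) / \<gamma> (Suc k))\<^sup>2 * (\<Sum>i<Suc k. \<gamma> i)) \<and>
     summable (\<lambda>k. \<epsilon> (Suc k) / \<gamma> (Suc k) * (\<Sum>i=1..Suc k. \<gamma> (i - 1))) \<and>
     filterlim (\<lambda>n. \<Sum>k<n. \<gamma> k) at_top sequentially"

end

theory Submission
  imports Defs
begin

text \<open>
  Project the epigraph of \<open>f\<close> over the violation graph to a convex set \<open>W\<close> of pairs
  \<open>(s, r)\<close>, so that the negative dual \<open>h\<close> is the support function of \<open>W\<close> in direction
  \<open>(\<lambda>, -1)\<close>. By strong convexity the augmented Lagrangian has a generalized minimizer
  \<open>q\<^sub>k\<close> in the closure of the attainable violations; it satisfies
  \<open>norm (s\<^sub>k\<^sub>+\<^sub>1 - q\<^sub>k) \<le> \<epsilon>\<^sub>k\<^sub>+\<^sub>1 / \<gamma>\<^sub>k\<close>, and it is a subgradient of \<open>h\<close> at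
  \<open>p\<^sub>k = \<lambda>\<^sub>k - \<gamma>\<^sub>k q\<^sub>k\<close>. The multipliers thus perform an inexact proximal point method on \<open>h\<close>.

  Monotonicity of the subdifferential makes \<open>(norm q\<^sub>k)\<^sup>2\<close> decrease up to the summable errors
  \<open>(\<epsilon>\<^sub>k / \<gamma>\<^sub>k)\<^sup>2\<close>. For \<open>u\<close> with \<open>h\<^sup>* u < \<infinity>\<close> the Fenchel gap
  \<open>h p\<^sub>k - \<langle>u, p\<^sub>k\<rangle> + h\<^sup>* u \<ge> 0\<close> drops by about \<open>\<gamma> \<langle>q - u, q\<rangle>\<close> in each step, so that
  \<open>(\<Sum>i<k. \<gamma>\<^sub>i) ((norm q\<^sub>k)\<^sup>2 - (norm u)\<^sup>2)\<close> stays bounded. Attainable \<open>u\<close> close to \<open>sbar\<close> give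
  convergence of the norms, and \<open>u = sbar\<close> gives the rate. Minimality of \<open>sbar\<close> and of the
  projection bound the squared distances in the theorem by \<open>(norm s)\<^sup>2 - (norm sbar)\<^sup>2\<close>.

  The values of \<open>f\<close> are bounded below by the supporting affine minorants, and above by comparing
  an iterate with \<open>sbar\<close> in the augmented Lagrangian; there the term
  \<open>\<langle>\<lambda>\<^sub>k, s\<^sub>k\<^sub>+\<^sub>1 - sbar\<rangle>\<close> vanishes because \<open>\<Sum>\<gamma>\<^sub>i (norm (s\<^sub>i\<^sub>+\<^sub>1 - sbar))\<^sup>2\<close> converges.
\<close>

section \<open>Proximal minimization and metric projection\<close>

text \<open>The augmented Lagrangian at the violation \<open>fst w\<close>, with the value of
  \<open>f\<close> replaced by a real number \<open>snd w\<close>, which keeps the analysis in the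
  reals.\<close>

definition augmented :: "'b::real_inner \<Rightarrow> real \<Rightarrow> 'b \<times> real \<Rightarrow> real" where
  "augmented l \<gamma> w = snd w - l \<bullet> fst w + \<gamma> / 2 * (norm (fst w))\<^sup>2"

text \<open>All terms but the squared norm are affine, so strong convexity in the first coordinate
  holds as an identity.\<close>

lemma augmented_convex_comb:
  "augmented l \<gamma> ((1 - t) *\<^sub>R v + t *\<^sub>R w) =
     (1 - t) * augmented l \<gamma> v + t * augmented l \<gamma> w - \<gamma> / 2 * (t * (1 - t)) * (norm (fst v - fst w))\<^sup>2"
  unfolding augmented_def
  by (simp add: power2_norm_eq_inner inner_add_left inner_add_right inner_diff_left inner_diff_right
      inner_commute[of "fst w" "fst v"] algebra_simps)
     (simp add: power2_eq_square field_simps)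

text \<open>The infimum \<open>I\<close> need not be attained on \<open>W\<close>. Strong convexity
  still makes the first coordinates of a minimizing sequence converge, and their limit
  \<open>q\<close> has the growth inequality of a true minimizer.\<close>

lemma proximal_point_exists:
  fixes W :: "('b::{real_inner, complete_space} \<times> real) set"
  assumes W: "convex W" and \<gamma>: "\<gamma> > 0"
    and lower: "\<And>w. w \<in> W \<Longrightarrow> I \<le> augmented l \<gamma> w"
    and approx: "\<And>d. d > 0 \<Longrightarrow> \<exists>w\<in>W. augmented l \<gamma> w < I + d"
  obtains q z where "\<And>n::nat. z n \<in> W" "(\<lambda>n. fst (z n)) \<longlonglongrightarrow> q"
    "(\<lambda>n. augmented l \<gamma> (z n)) \<longlonglongrightarrow> I"
    "\<And>w. w \<in> W \<Longrightarrow> I + \<gamma> / 2 * (norm (fst w - q))\<^sup>2 \<le> augmented l \<gamma> w"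
proof -
  have "\<forall>n. \<exists>w\<in>W. augmented l \<gamma> w < I + inverse (real (Suc n))"
    by (intro allI approx) simp
  then obtain z where z: "\<And>n. z n \<in> W" "\<And>n. augmented l \<gamma> (z n) < I + inverse (real (Suc n))"
    by metis
  have strong: "\<gamma> / 2 * (t * (1 - t)) * (norm (fst v - fst w))\<^sup>2
      \<le> (1 - t) * augmented l \<gamma> v + t * augmented l \<gamma> w - I"
    if "v \<in> W" "w \<in> W" "0 \<le> t" "t \<le> 1" for v w t
  proof -
    have "(1 - t) *\<^sub>R v + t *\<^sub>R w \<in> W"
      using W that by (simp add: convex_alt)
    from lower[OF this] show ?thesis
      by (simp add: augmented_convex_comb)
  qed
  have "Cauchy (\<lambda>n. fst (z n))"
  proof (rule metric_CauchyI)
    fix e :: real assume e: "e > 0"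
    then have "\<gamma> * e\<^sup>2 / 8 > 0" using \<gamma> by simp
    then obtain N where N: "inverse (real (Suc N)) < \<gamma> * e\<^sup>2 / 8"
      using reals_Archimedean by blast
    have "dist (fst (z m)) (fst (z n)) < e" if "m \<ge> N" "n \<ge> N" for m n
    proof -
      have inv: "inverse (real (Suc k)) \<le> inverse (real (Suc N))" if "k \<ge> N" for k
        using that by (simp add: field_simps)
      \<comment> \<open>At the midpoint \<open>t = 1/2\<close> the modulus
        \<open>\<gamma> / 2 * (t * (1 - t))\<close> is \<open>\<gamma> / 8\<close>, which explains
        the choice of \<open>N\<close>.\<close>
      have "\<gamma> / 8 * (norm (fst (z m) - fst (z n)))\<^sup>2
          \<le> augmented l \<gamma> (z m) / 2 + augmented l \<gamma> (z n) / 2 - I"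
        using strong[OF z(1) z(1), of "1/2" m n] by simp
      also have "\<dots> < \<gamma> / 8 * e\<^sup>2"
        using z(2)[of m] z(2)[of n] inv[OF \<open>m \<ge> N\<close>] inv[OF \<open>n \<ge> N\<close>] N by linarith
      finally have "(norm (fst (z m) - fst (z n)))\<^sup>2 < e\<^sup>2" using \<gamma> by simp
      then show ?thesis using e by (simp add: dist_norm power2_less_imp_less)
    qed
    then show "\<exists>M. \<forall>m\<ge>M. \<forall>n\<ge>M. dist (fst (z m)) (fst (z n)) < e" by blast
  qed
  then obtain q where q: "(\<lambda>n. fst (z n)) \<longlonglongrightarrow> q"
    using Cauchy_convergent convergent_def by blast
  have lim: "(\<lambda>n. augmented l \<gamma> (z n)) \<longlonglongrightarrow> I"
  proof (rule tendsto_sandwich)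
    show "\<forall>\<^sub>F n in sequentially. I \<le> augmented l \<gamma> (z n)" using lower z by simp
    show "\<forall>\<^sub>F n in sequentially. augmented l \<gamma> (z n) \<le> I + inverse (real (Suc n))"
      using z(2) by (intro always_eventually allI less_imp_le)
    show "(\<lambda>n. I + inverse (real (Suc n))) \<longlonglongrightarrow> I"
      using tendsto_add[OF tendsto_const LIMSEQ_inverse_real_of_nat, of I] by simp
  qed simp
  have growth: "I + \<gamma> / 2 * (norm (fst w - q))\<^sup>2 \<le> augmented l \<gamma> w" if w: "w \<in> W" for w
  proof -
    \<comment> \<open>The limit along \<open>z n\<close> is taken first and a factor
      \<open>t\<close> cancelled; letting \<open>t\<close> tend to 0 from the right then recovers
      the full modulus \<open>\<gamma> / 2\<close>.\<close>
    have part: "\<gamma> / 2 * (1 - t) * (norm (q - fst w))\<^sup>2 \<le> augmented l \<gamma> w - I"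
      if t: "0 < t" "t < 1" for t
    proof -
      have "\<gamma> / 2 * (t * (1 - t)) * (norm (q - fst w))\<^sup>2
          \<le> (1 - t) * I + t * augmented l \<gamma> w - I"
      proof (rule LIMSEQ_le)
        show "(\<lambda>n. \<gamma> / 2 * (t * (1 - t)) * (norm (fst (z n) - fst w))\<^sup>2)
            \<longlonglongrightarrow> \<gamma> / 2 * (t * (1 - t)) * (norm (q - fst w))\<^sup>2"
          by (intro tendsto_intros q)
        show "(\<lambda>n. (1 - t) * augmented l \<gamma> (z n) + t * augmented l \<gamma> w - I)
            \<longlonglongrightarrow> (1 - t) * I + t * augmented l \<gamma> w - I"
          by (intro tendsto_intros lim)
      qed (use strong[OF z(1) w] t in auto)
      then have "t * (\<gamma> / 2 * (1 - t) * (norm (q - fst w))\<^sup>2) \<le> t * (augmented l \<gamma> w - I)"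
        by (simp add: algebra_simps)
      then show ?thesis using t by (simp only: mult_le_cancel_left_pos)
    qed
    have "\<gamma> / 2 * (1 - 0) * (norm (q - fst w))\<^sup>2 \<le> augmented l \<gamma> w - I"
    proof (rule tendsto_upperbound)
      show "((\<lambda>t. \<gamma> / 2 * (1 - t) * (norm (q - fst w))\<^sup>2) \<longlongrightarrow>
          \<gamma> / 2 * (1 - 0) * (norm (q - fst w))\<^sup>2) (at_right 0)"
        by (intro tendsto_intros)
      show "\<forall>\<^sub>F t in at_right 0. \<gamma> / 2 * (1 - t) * (norm (q - fst w))\<^sup>2 \<le> augmented l \<gamma> w - I"
        using part eventually_at_right_real[of 0 1] by (auto elim!: eventually_mono)
    qed simp
    then show ?thesis by (simp add: norm_minus_commute)
  qed
  show ?thesis using that z(1) q lim growth by blast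
qed

text \<open>The projection is the proximal point of the zero function on \<open>A\<close>.\<close>

lemma projection_exists:
  fixes A :: "'b::{real_inner, complete_space} set"
  assumes A: "A \<noteq> {}" "closed A" "convex A"
  obtains p where "p \<in> A" "\<And>z. z \<in> A \<Longrightarrow> (norm (p - u))\<^sup>2 + (norm (z - p))\<^sup>2 \<le> (norm (z - u))\<^sup>2"
proof -
  define W where "W = A \<times> {0::real}"
  \<comment> \<open>Completing the square: up to a constant, half the squared distance from
    \<open>u\<close>.\<close>
  have aug: "augmented u 1 (z, 0) = ((norm (z - u))\<^sup>2 - (norm u)\<^sup>2) / 2" for z
    by (simp add: augmented_def power2_norm_eq_inner inner_diff_left inner_diff_right
        inner_commute field_simps)
  let ?I = "INF w\<in>W. augmented u 1 w"
  have bdd: "bdd_below (augmented u 1 ` W)"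
    by (rule bdd_belowI[of _ "- (norm u)\<^sup>2 / 2"]) (auto simp: W_def aug)
  have "\<exists>w\<in>W. augmented u 1 w < ?I + d" if "d > 0" for d
    using cInf_lessD[of "augmented u 1 ` W" "?I + d"] that A(1) by (force simp: W_def)
  note approx = this
  have "convex W" unfolding W_def by (intro convex_Times A) simp
  moreover have "?I \<le> augmented u 1 w" if "w \<in> W" for w using bdd that by (rule cINF_lower)
  ultimately obtain q z where z: "\<And>n::nat. z n \<in> W" and q: "(\<lambda>n. fst (z n)) \<longlonglongrightarrow> q"
    and lim: "(\<lambda>n. augmented u 1 (z n)) \<longlonglongrightarrow> ?I"
    and growth: "\<And>w. w \<in> W \<Longrightarrow> ?I + 1 / 2 * (norm (fst w - q))\<^sup>2 \<le> augmented u 1 w"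
    by (rule proximal_point_exists[OF _ zero_less_one _ approx]) (assumption+, rule that)
  have zA: "fst (z n) \<in> A" "z n = (fst (z n), 0)" for n using z[of n] by (auto simp: W_def)
  have "(\<lambda>n. ((norm (fst (z n) - u))\<^sup>2 - (norm u)\<^sup>2) / 2) \<longlonglongrightarrow> ((norm (q - u))\<^sup>2 - (norm u)\<^sup>2) / 2"
    by (intro tendsto_intros q) simp
  moreover have "(\<lambda>n. ((norm (fst (z n) - u))\<^sup>2 - (norm u)\<^sup>2) / 2) = (\<lambda>n. augmented u 1 (z n))"
    using zA(2) aug by metis
  ultimately have I: "?I = ((norm (q - u))\<^sup>2 - (norm u)\<^sup>2) / 2"
    using lim LIMSEQ_unique by metis
  have "q \<in> A" using closed_sequentially[OF A(2) _ q] zA by simp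
  moreover have "(norm (q - u))\<^sup>2 + (norm (z - q))\<^sup>2 \<le> (norm (z - u))\<^sup>2" if "z \<in> A" for z
    using growth[of "(z, 0)", unfolded I] that by (simp add: W_def aug field_simps)
  ultimately show ?thesis using that by blast
qed

text \<open>\<open>arg_min_on\<close> is a choice operator, so a minimizer \<open>p'\<close> has to
  be exhibited first; its Pythagorean inequality then forces every other minimizer to coincide with
  it.\<close>

lemma arg_min_dist_ineq:
  fixes A :: "'b::{real_inner, complete_space} set" and u :: 'b
  assumes A: "A \<noteq> {}" "closed A" "convex A"
  defines "p \<equiv> arg_min_on (\<lambda>z. dist u z) A"
  shows "p \<in> A" and "z \<in> A \<Longrightarrow> (norm (p - u))\<^sup>2 + (norm (z - p))\<^sup>2 \<le> (norm (z - u))\<^sup>2"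
proof -
  obtain p' where p': "p' \<in> A"
    "\<And>z. z \<in> A \<Longrightarrow> (norm (p' - u))\<^sup>2 + (norm (z - p'))\<^sup>2 \<le> (norm (z - u))\<^sup>2"
    using projection_exists[OF A] by blast
  have "dist u p' \<le> dist u z" if "z \<in> A" for z
  proof (rule power2_le_imp_le)
    show "(dist u p')\<^sup>2 \<le> (dist u z)\<^sup>2"
      using p'(2)[OF that] zero_le_power2[of "norm (z - p')"] unfolding dist_norm norm_minus_commute[of u] by linarith
  qed simp
  then have "is_arg_min (\<lambda>z. dist u z) (\<lambda>z. z \<in> A) p'"
    using p'(1) by (auto simp: is_arg_min_linorder)
  then have "is_arg_min (\<lambda>z. dist u z) (\<lambda>z. z \<in> A) p"
    unfolding p_def arg_min_on_def arg_min_def by (rule someI)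
  then have p: "p \<in> A" "dist u p \<le> dist u p'" using p'(1) by (auto simp: is_arg_min_linorder)
  have "(norm (p - u))\<^sup>2 \<le> (norm (p' - u))\<^sup>2"
    using p(2) by (simp add: dist_norm norm_minus_commute)
  then have "(norm (p - p'))\<^sup>2 \<le> 0" using p'(2)[OF p(1)] by linarith
  then have "p = p'" by simp
  then show "p \<in> A" "z \<in> A \<Longrightarrow> (norm (p - u))\<^sup>2 + (norm (z - p))\<^sup>2 \<le> (norm (z - u))\<^sup>2"
    using p' by auto
qed

section \<open>Inexact proximal point sequences\<close>

text \<open>\<open>H k\<close> stands for the value of a convex function at \<open>p k\<close>, and
  \<open>q k\<close> for a subgradient there, tested only against the points of the sequence. The
  step is implicit: it uses the subgradient at the new point.\<close>

locale inexact_proximal_sequence =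
  fixes p e q :: "nat \<Rightarrow> 'b::real_inner" and g a H :: "nat \<Rightarrow> real"
  assumes step: "p (Suc k) = p k + e k - g k *\<^sub>R q (Suc k)"
    and e: "norm (e k) \<le> a k" and g: "g k > 0"
    and sub: "H k + q k \<bullet> (p j - p k) \<le> H j"
begin

text \<open>Adding two subgradient inequalities gives monotonicity, so without errors
  \<open>D \<bullet> q (Suc k)\<close> is at most 0 and the norms decrease. The error contributes at
  most \<open>2 * (norm D * (a k / g k))\<close>, which \<open>- (norm D)\<^sup>2\<close> absorbs up
  to \<open>(a k / g k)\<^sup>2\<close>.\<close>

lemma norm_square_step:
  "(norm (q (Suc k)))\<^sup>2 \<le> (norm (q k))\<^sup>2 + (a k / g k)\<^sup>2"
proof -
  define D where "D = q (Suc k) - q k"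
  have "D \<bullet> (p (Suc k) - p k) \<ge> 0"
    using sub[of k "Suc k"] sub[of "Suc k" k]
    by (simp add: D_def inner_diff_left inner_diff_right)
  moreover have "p (Suc k) - p k = e k - g k *\<^sub>R q (Suc k)" using step[of k] by simp
  ultimately have "g k * (D \<bullet> q (Suc k)) \<le> D \<bullet> e k" by (simp add: inner_diff_right)
  also have "\<dots> \<le> norm D * a k"
    by (meson e[of k] mult_left_mono norm_cauchy_schwarz norm_ge_zero order_trans)
  finally have "D \<bullet> q (Suc k) \<le> norm D * (a k / g k)" using g[of k] by (simp add: field_simps)
  moreover have "(norm (q (Suc k)))\<^sup>2 = (norm (q k))\<^sup>2 + 2 * (D \<bullet> q (Suc k)) - (norm D)\<^sup>2"
    by (simp add: D_def power2_norm_eq_inner inner_diff_left inner_diff_right inner_commute)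
  moreover have "2 * (norm D * (a k / g k)) - (norm D)\<^sup>2 \<le> (a k / g k)\<^sup>2"
    using zero_le_power2[of "norm D - a k / g k"] by (simp add: power2_eq_square algebra_simps)
  ultimately show ?thesis by linarith
qed

lemma bounded_by_summable:
  assumes sum: "summable (\<lambda>k. (a k / g k)\<^sup>2)"
  obtains M where "M \<ge> 0" "\<And>k. norm (q k) \<le> M"
proof -
  have le: "(norm (q k))\<^sup>2 \<le> (norm (q 0))\<^sup>2 + (\<Sum>j<k. (a j / g j)\<^sup>2)" for k
  proof (induction k)
    case (Suc k)
    have "(norm (q (Suc k)))\<^sup>2 \<le> (norm (q k))\<^sup>2 + (a k / g k)\<^sup>2"
      by (rule norm_square_step)
    then show ?case using Suc by simp
  qed simp
  let ?B = "(norm (q 0))\<^sup>2 + (\<Sum>j. (a j / g j)\<^sup>2)"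
  have B: "(norm (q k))\<^sup>2 \<le> ?B" for k
    using le[of k] sum_le_suminf[OF sum, of "{..<k}"] by simp
  have "norm (q k) \<le> sqrt ?B" for k using B[of k] by (simp add: real_le_rsqrt)
  moreover have "sqrt ?B \<ge> 0" using calculation norm_ge_zero order_trans by metis
  ultimately show ?thesis using that by blast
qed

text \<open>The constant \<open>c\<close> acts as a bound on the conjugate at \<open>u\<close>, so
  the Fenchel gap \<open>\<Phi>\<close> is nonnegative; the subgradient inequality at the new point
  makes the sum telescope against it.\<close>

lemma energy_bound:
  assumes sum: "summable a" and M: "M \<ge> 0" "\<And>k. norm (q k) \<le> M"
    and lower: "\<And>k. H k \<ge> u \<bullet> p k - c"
  obtains B where "\<And>k. (\<Sum>j<k. g j * ((q (Suc j) - u) \<bullet> q (Suc j))) \<le> B"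
proof -
  define \<Phi> where "\<Phi> k = H k - u \<bullet> p k + c" for k
  have le: "(\<Sum>j<k. g j * ((q (Suc j) - u) \<bullet> q (Suc j))) \<le> \<Phi> 0 - \<Phi> k + (\<Sum>j<k. (M + norm u) * a j)" for k
  proof (induction k)
    case (Suc k)
    have "g k * ((q (Suc k) - u) \<bullet> q (Suc k)) = (q (Suc k) - u) \<bullet> (p k - p (Suc k)) + (q (Suc k) - u) \<bullet> e k"
      by (simp add: step algebra_simps)
    also have "\<dots> \<le> (\<Phi> k - \<Phi> (Suc k)) + (M + norm u) * a k"
    proof (rule add_mono)
      show "(q (Suc k) - u) \<bullet> (p k - p (Suc k)) \<le> \<Phi> k - \<Phi> (Suc k)"
        using sub[of "Suc k" k] by (simp add: \<Phi>_def inner_diff_left inner_diff_right)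
      have "(q (Suc k) - u) \<bullet> e k \<le> norm (q (Suc k) - u) * norm (e k)" by (rule norm_cauchy_schwarz)
      also have "\<dots> \<le> (M + norm u) * a k"
        using norm_triangle_ineq4[of "q (Suc k)" u] M(2)[of "Suc k"] M(1) e
        by (intro mult_mono) auto
      finally show "(q (Suc k) - u) \<bullet> e k \<le> (M + norm u) * a k" .
    qed
    finally show ?case using Suc by simp
  qed simp
  have "a j \<ge> 0" for j using e[of j] norm_ge_zero order_trans by blast
  then have tail: "(\<Sum>j<k. (M + norm u) * a j) \<le> (\<Sum>j. (M + norm u) * a j)" for k
    using M(1) sum by (intro sum_le_suminf) (auto intro: summable_mult)
  have "\<Phi> k \<ge> 0" for k using lower[of k] by (simp add: \<Phi>_def)
  then have "(\<Sum>j<k. g j * ((q (Suc j) - u) \<bullet> q (Suc j))) \<le> \<Phi> 0 + (\<Sum>j. (M + norm u) * a j)" for k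
  proof -
    have "\<Phi> k \<ge> 0" by fact
    then show ?thesis using le[of k] tail[of k] by linarith
  qed
  then show ?thesis using that by blast
qed

text \<open>Since \<open>D\<close> is almost nonincreasing, its last value times the total weight is
  at most the weighted sum of its values, up to the increases \<open>(a k / g k)\<^sup>2\<close>,
  each counted with the weight accumulated so far.\<close>

lemma weighted_excess_bound:
  assumes sum: "summable a" and M: "M \<ge> 0" "\<And>k. norm (q k) \<le> M"
    and sum2: "summable (\<lambda>k. (a k / g k)\<^sup>2 * (\<Sum>i<k. g i))"
    and lower: "\<And>k. H k \<ge> u \<bullet> p k - c"
  obtains B where "\<And>k. (\<Sum>i<k. g i) * ((norm (q k))\<^sup>2 - (norm u)\<^sup>2) \<le> B"
proof -
  define D where "D k = (norm (q k))\<^sup>2 - (norm u)\<^sup>2" for k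
  define T where "T k = (\<Sum>i<k. g i)" for k
  have T: "T k \<ge> 0" for k unfolding T_def using g by (simp add: sum_nonneg less_imp_le)
  obtain B where B: "\<And>k. (\<Sum>j<k. g j * ((q (Suc j) - u) \<bullet> q (Suc j))) \<le> B"
    using energy_bound[OF sum M lower] by blast
  \<comment> \<open>The two sides differ by \<open>(norm (q k - u))\<^sup>2\<close>.\<close>
  have "D k \<le> 2 * ((q k - u) \<bullet> q k)" for k
    using zero_le_power2[of "norm (q k - u)"]
    by (simp add: D_def power2_norm_eq_inner inner_diff_left inner_diff_right inner_commute)
  then have "g j * D (Suc j) \<le> g j * (2 * ((q (Suc j) - u) \<bullet> q (Suc j)))" for j
    using g[of j] by (intro mult_left_mono) auto
  then have "g j * D (Suc j) \<le> 2 * (g j * ((q (Suc j) - u) \<bullet> q (Suc j)))" for j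
    by (simp add: mult.left_commute)
  then have "(\<Sum>j<k. g j * D (Suc j)) \<le> 2 * (\<Sum>j<k. g j * ((q (Suc j) - u) \<bullet> q (Suc j)))" for k
    unfolding sum_distrib_left by (rule sum_mono)
  then have gD: "(\<Sum>j<k. g j * D (Suc j)) \<le> 2 * B" for k
    by (rule order_trans) (simp add: B)
  have le: "T k * D k \<le> (\<Sum>j<k. g j * D (Suc j)) + (\<Sum>j<k. (a j / g j)\<^sup>2 * T j)" for k
  proof (induction k)
    case (Suc k)
    have "D (Suc k) \<le> D k + (a k / g k)\<^sup>2"
      unfolding D_def using norm_square_step[of k] by linarith
    then have "T k * D (Suc k) \<le> T k * (D k + (a k / g k)\<^sup>2)" using T by (rule mult_left_mono)
    moreover have "T (Suc k) * D (Suc k) = T k * D (Suc k) + g k * D (Suc k)"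
      by (simp add: T_def algebra_simps)
    ultimately show ?case using Suc by (simp add: algebra_simps)
  qed (simp add: T_def)
  have tail: "(\<Sum>j<k. (a j / g j)\<^sup>2 * T j) \<le> (\<Sum>j. (a j / g j)\<^sup>2 * T j)" for k
    using sum2 T by (intro sum_le_suminf) (auto simp: T_def)
  have "T k * D k \<le> 2 * B + (\<Sum>j. (a j / g j)\<^sup>2 * T j)" for k
    using le[of k] add_mono[OF gD[of k] tail[of k]] by (rule order_trans)
  then show ?thesis using that unfolding T_def D_def by blast
qed

end

section \<open>A limit of normalized weighted sums\<close>

text \<open>Cauchy-Schwarz applied to the whole sum yields only boundedness. Applied from a late
  index \<open>N\<close> on, it brings in a small tail of the convergent series, while the fixed
  initial part \<open>A\<close> is negligible against the divergent denominator.\<close>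

lemma weighted_sum_over_sqrt_tendsto_0:
  fixes w d :: "nat \<Rightarrow> real"
  assumes w: "\<And>i. w i > 0" and d: "\<And>i. d i \<ge> 0"
    and div: "filterlim (\<lambda>n. \<Sum>i<n. w i) at_top sequentially"
    and sum: "summable (\<lambda>i. w i * (d i)\<^sup>2)"
  shows "(\<lambda>n. (\<Sum>i<n. w i * d i) / sqrt (\<Sum>i<n. w i)) \<longlonglongrightarrow> 0"
proof (rule LIMSEQ_I)
  fix r :: real assume r: "r > 0"
  define \<sigma> where "\<sigma> n = (\<Sum>i<n. w i)" for n
  have "(r / 2)\<^sup>2 > 0" using r by simp
  then obtain N where N: "\<And>n. norm (\<Sum>i=N..<n. w i * (d i)\<^sup>2) < (r / 2)\<^sup>2"
    using sum[unfolded summable_Cauchy] by blast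
  define A where "A = (\<Sum>i<N. w i * d i)"
  have "filterlim (\<lambda>n. sqrt (\<sigma> n)) at_top sequentially"
    unfolding \<sigma>_def by (rule filterlim_compose[OF sqrt_at_top div])
  then have "\<forall>\<^sub>F n in sequentially. sqrt (\<sigma> n) > max 1 (2 * A / r)"
    unfolding filterlim_at_top_dense by blast
  then have "\<forall>\<^sub>F n in sequentially. sqrt (\<sigma> n) > max 1 (2 * A / r) \<and> n \<ge> N"
    by (intro eventually_conj eventually_ge_at_top)
  then show "\<exists>no. \<forall>n\<ge>no. norm ((\<Sum>i<n. w i * d i) / sqrt (\<Sum>i<n. w i) - 0) < r"
    unfolding eventually_sequentially
  proof (elim exE, intro exI allI impI)
    fix n0 n assume "\<forall>n\<ge>n0. sqrt (\<sigma> n) > max 1 (2 * A / r) \<and> n \<ge> N" "n0 \<le> n"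
    then have big: "sqrt (\<sigma> n) > 1" "sqrt (\<sigma> n) > 2 * A / r" and n: "n \<ge> N" by auto
    have split: "(\<Sum>i<n. h i) = (\<Sum>i<N. h i) + (\<Sum>i=N..<n. h i)" for h :: "nat \<Rightarrow> real"
      using n by (metis atLeast0LessThan sum.atLeastLessThan_concat zero_le)
    have "(\<Sum>i=N..<n. w i * d i) = (\<Sum>i=N..<n. sqrt (w i) * (sqrt (w i) * d i))"
      using w by (simp add: mult.assoc[symmetric] less_imp_le)
    also have "\<dots> \<le> sqrt (\<Sum>i=N..<n. (sqrt (w i))\<^sup>2) * sqrt (\<Sum>i=N..<n. (sqrt (w i) * d i)\<^sup>2)"
      using L2_set_mult_ineq[of "\<lambda>i. sqrt (w i)" "\<lambda>i. sqrt (w i) * d i" "{N..<n}"] w d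
      by (simp add: L2_set_def abs_mult less_imp_le)
    also have "\<dots> = sqrt (\<Sum>i=N..<n. w i) * sqrt (\<Sum>i=N..<n. w i * (d i)\<^sup>2)"
      using w by (simp add: power_mult_distrib less_imp_le)
    also have "\<dots> \<le> sqrt (\<sigma> n) * (r / 2)"
    proof (rule mult_mono)
      have "(\<Sum>i<N. w i) \<ge> 0" using w by (simp add: sum_nonneg less_imp_le)
      then show "sqrt (\<Sum>i=N..<n. w i) \<le> sqrt (\<sigma> n)" unfolding \<sigma>_def split[of w] by simp
      show "sqrt (\<Sum>i=N..<n. w i * (d i)\<^sup>2) \<le> r / 2"
        using N[of n] r by (intro real_le_lsqrt) (auto intro!: sum_nonneg simp: w less_imp_le)
    qed (use big w in \<open>auto intro!: sum_nonneg simp: less_imp_le\<close>)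
    finally have "(\<Sum>i<n. w i * d i) \<le> A + sqrt (\<sigma> n) * (r / 2)"
      unfolding A_def split[of "\<lambda>i. w i * d i"] by simp
    also have "\<dots> < sqrt (\<sigma> n) * r" using big(2) r by (simp add: field_simps)
    finally have "(\<Sum>i<n. w i * d i) / sqrt (\<sigma> n) < r" using big(1) by (simp add: field_simps)
    moreover have "(\<Sum>i<n. w i * d i) \<ge> 0" using w d by (simp add: sum_nonneg less_imp_le)
    ultimately show "norm ((\<Sum>i<n. w i * d i) / sqrt (\<Sum>i<n. w i) - 0) < r"
      using big(1) by (simp add: \<sigma>_def)
  qed
qed

section \<open>Asymptotics of the inexact augmented Lagrangian sequence\<close>

text \<open>Here \<open>v k\<close> and \<open>r k\<close> are violation and value of the iterate
  with index \<open>Suc k\<close>. Together \<open>upper\<close> and \<open>least\<close> say that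
  \<open>H k\<close> is the supremum defining the negative dual at
  \<open>l k - \<gamma> k *\<^sub>R q k\<close>, and that \<open>q k\<close> is a subgradient
  there.\<close>

locale inexact_augmented_lagrangian =
  fixes W :: "('b::{real_inner, complete_space} \<times> real) set"
    and \<gamma> \<epsilon> :: "nat \<Rightarrow> real" and l v q :: "nat \<Rightarrow> 'b" and r H :: "nat \<Rightarrow> real" and sbar :: 'b
  assumes conditions: "error_step_conditions \<gamma> \<epsilon>"
    and multiplier: "\<And>k. l (Suc k) = l k - \<gamma> k *\<^sub>R v k"
    and iterate: "\<And>k. (v k, r k) \<in> W"
    and near: "\<And>k. norm (v k - q k) \<le> \<epsilon> (Suc k) / \<gamma> k"
    and q_closure: "\<And>k. q k \<in> closure (fst ` W)"
    and upper: "\<And>k w. w \<in> W \<Longrightarrow> (l k - \<gamma> k *\<^sub>R q k) \<bullet> fst w - snd w \<le> H k"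
    and least: "\<And>k m G. (\<And>w. w \<in> W \<Longrightarrow> m \<bullet> fst w - snd w \<le> G) \<Longrightarrow>
      H k + q k \<bullet> (m - (l k - \<gamma> k *\<^sub>R q k)) \<le> G"
    and gap: "\<And>k. augmented (l k) (\<gamma> k) (v k, r k)
      \<le> - H k - \<gamma> k / 2 * (norm (q k))\<^sup>2 + (\<epsilon> (Suc k))\<^sup>2 / (2 * \<gamma> k)"
    and sbar_closure: "sbar \<in> closure (fst ` W)"
    and sbar_minimal: "\<And>z. z \<in> closure (fst ` W) \<Longrightarrow> (norm sbar)\<^sup>2 + (norm (z - sbar))\<^sup>2 \<le> (norm z)\<^sup>2"
begin

definition p :: "nat \<Rightarrow> 'b" where "p k = l k - \<gamma> k *\<^sub>R q k"

text \<open>The multiplier error: \<open>l (Suc k)\<close> equals \<open>p k + e k\<close>, where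
  \<open>p k\<close> is the update by the exact proximal point.\<close>

definition e :: "nat \<Rightarrow> 'b" where "e k = \<gamma> k *\<^sub>R (q k - v k)"

definition \<sigma> :: "nat \<Rightarrow> real" where "\<sigma> k = (\<Sum>i<k. \<gamma> i)"

definition \<delta> :: "nat \<Rightarrow> real" where "\<delta> k = \<epsilon> (Suc k) / \<gamma> k"

lemma \<gamma>_pos: "\<gamma> k > 0"
  using conditions by (simp add: error_step_conditions_def)

lemma \<epsilon>_nonneg: "\<epsilon> (Suc k) \<ge> 0"
  using conditions by (simp add: error_step_conditions_def)

lemma \<delta>_nonneg: "\<delta> k \<ge> 0"
  using \<gamma>_pos \<epsilon>_nonneg by (simp add: \<delta>_def less_imp_le)

lemma summable_\<epsilon>: "summable (\<lambda>k. \<epsilon> (Suc k))"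
  using conditions by (simp add: error_step_conditions_def)

lemma \<sigma>_at_top: "filterlim \<sigma> at_top sequentially"
  using conditions by (simp add: error_step_conditions_def \<sigma>_def[abs_def])

lemma \<sigma>_Suc: "\<sigma> (Suc k) = \<gamma> 0 + (\<Sum>i<k. \<gamma> (Suc i))"
  unfolding \<sigma>_def by (rule sum.lessThan_Suc_shift)

lemma \<sigma>_Suc_ge: "\<gamma> 0 \<le> \<sigma> (Suc k)"
  unfolding \<sigma>_Suc using \<gamma>_pos by (simp add: sum_nonneg less_imp_le)

lemma \<sigma>_Suc_pos: "\<sigma> (Suc k) > 0"
  using \<sigma>_Suc_ge \<gamma>_pos[of 0] by (rule less_le_trans[rotated])

lemma p_Suc: "p (Suc k) = p k + e k - \<gamma> (Suc k) *\<^sub>R q (Suc k)"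
  by (simp add: p_def e_def multiplier algebra_simps)

lemma norm_e_le: "norm (e k) \<le> \<epsilon> (Suc k)"
proof -
  have "norm (e k) = \<gamma> k * norm (v k - q k)"
    using \<gamma>_pos[of k] by (simp add: e_def norm_minus_commute)
  also have "\<dots> \<le> \<gamma> k * (\<epsilon> (Suc k) / \<gamma> k)"
    using near \<gamma>_pos[of k] by (intro mult_left_mono) auto
  finally show ?thesis using \<gamma>_pos[of k] by simp
qed

lemma subgradient: "H k + q k \<bullet> (p j - p k) \<le> H j"
  unfolding p_def by (rule least[OF upper])

text \<open>The step from \<open>p k\<close> to \<open>p (Suc k)\<close> has length
  \<open>\<gamma> (Suc k)\<close>, but its error stems from iteration \<open>k\<close> and is
  bounded by \<open>\<epsilon> (Suc k)\<close>; hence the ratios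
  \<open>\<epsilon> (Suc k) / \<gamma> (Suc k)\<close>.\<close>

sublocale inexact_proximal_sequence p e q "\<lambda>k. \<gamma> (Suc k)" "\<lambda>k. \<epsilon> (Suc k)" H
  by unfold_locales (fact p_Suc norm_e_le \<gamma>_pos subgradient)+

lemma summable_ratio_\<sigma>: "summable (\<lambda>k. (\<epsilon> (Suc k) / \<gamma> (Suc k))\<^sup>2 * \<sigma> (Suc k))"
  using conditions by (simp add: error_step_conditions_def \<sigma>_def)

lemma summable_ratio: "summable (\<lambda>k. (\<epsilon> (Suc k) / \<gamma> (Suc k))\<^sup>2)"
proof (rule summable_comparison_test')
  show "summable (\<lambda>k. 1 / \<gamma> 0 * ((\<epsilon> (Suc k) / \<gamma> (Suc k))\<^sup>2 * \<sigma> (Suc k)))"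
    by (intro summable_mult summable_ratio_\<sigma>)
  fix k
  have "(\<epsilon> (Suc k) / \<gamma> (Suc k))\<^sup>2 * \<gamma> 0 \<le> (\<epsilon> (Suc k) / \<gamma> (Suc k))\<^sup>2 * \<sigma> (Suc k)"
    by (intro mult_left_mono \<sigma>_Suc_ge) simp
  then show "norm ((\<epsilon> (Suc k) / \<gamma> (Suc k))\<^sup>2) \<le> 1 / \<gamma> 0 * ((\<epsilon> (Suc k) / \<gamma> (Suc k))\<^sup>2 * \<sigma> (Suc k))"
    using \<gamma>_pos[of 0] by (simp add: pos_le_divide_eq)
qed

lemma summable_ratio_tail: "summable (\<lambda>k. (\<epsilon> (Suc k) / \<gamma> (Suc k))\<^sup>2 * (\<Sum>i<k. \<gamma> (Suc i)))"
proof (rule summable_comparison_test'[OF summable_ratio_\<sigma>])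
  fix k
  have "(\<Sum>i<k. \<gamma> (Suc i)) \<ge> 0" using \<gamma>_pos by (simp add: sum_nonneg less_imp_le)
  then show "norm ((\<epsilon> (Suc k) / \<gamma> (Suc k))\<^sup>2 * (\<Sum>i<k. \<gamma> (Suc i))) \<le> (\<epsilon> (Suc k) / \<gamma> (Suc k))\<^sup>2 * \<sigma> (Suc k)"
    using \<gamma>_pos[of 0] unfolding \<sigma>_Suc by (simp add: mult_left_mono)
qed

lemma q_bounded: obtains M where "M \<ge> 0" "\<And>k. norm (q k) \<le> M"
  using bounded_by_summable[OF summable_ratio] by blast

lemma \<delta>_\<sigma>_bounded: obtains c where "\<And>k. \<sigma> (Suc k) * \<delta> k \<le> c"
proof -
  have "(\<lambda>k. \<sigma> (Suc k) * \<delta> k) \<in> O(\<lambda>k. 1 / sqrt (\<sigma> (Suc k)))"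
    using conditions by (simp add: error_step_conditions_def \<sigma>_def \<delta>_def lessThan_Suc_atMost mult.commute)
  then obtain c where c: "c > 0"
    "\<forall>\<^sub>F k in sequentially. norm (\<sigma> (Suc k) * \<delta> k) \<le> c * norm (1 / sqrt (\<sigma> (Suc k)))"
    by (rule landau_o.bigE)
  have "norm (1 / sqrt (\<sigma> (Suc k))) \<le> 1 / sqrt (\<gamma> 0)" for k
    using \<sigma>_Suc_ge[of k] \<sigma>_Suc_pos[of k] \<gamma>_pos[of 0] by (simp add: frac_le)
  then have "c * norm (1 / sqrt (\<sigma> (Suc k))) \<le> c * (1 / sqrt (\<gamma> 0))" for k
    using c(1) by (intro mult_left_mono) auto
  then have "\<forall>\<^sub>F k in sequentially. norm (\<sigma> (Suc k) * \<delta> k) \<le> c * (1 / sqrt (\<gamma> 0))"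
    using c(2) by (auto elim!: eventually_mono intro: order_trans)
  \<comment> \<open>Passing through \<open>Bseq\<close> extends the eventual bound to all
    indices.\<close>
  then have "Bseq (\<lambda>k. \<sigma> (Suc k) * \<delta> k)" by (rule BfunI)
  then obtain c' where "\<forall>k. norm (\<sigma> (Suc k) * \<delta> k) \<le> c'" by (rule BseqE)
  then have "\<sigma> (Suc k) * \<delta> k \<le> c'" for k by (metis abs_le_D1 real_norm_def)
  then show ?thesis by (rule that)
qed

lemma \<delta>_bounded: obtains D where "\<And>k. \<delta> k \<le> D"
proof -
  obtain c where c: "\<And>k. \<sigma> (Suc k) * \<delta> k \<le> c" using \<delta>_\<sigma>_bounded by blast
  have "\<gamma> 0 * \<delta> k \<le> c" for k
    using c[of k] mult_right_mono[OF \<sigma>_Suc_ge \<delta>_nonneg, of k k] by linarith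
  then have "\<delta> k \<le> c / \<gamma> 0" for k using \<gamma>_pos[of 0] by (simp add: field_simps)
  then show ?thesis using that by blast
qed

text \<open>Replacing \<open>q k\<close> by \<open>v k\<close> raises the squared norm by at most
  \<open>(2 * M + D) * \<delta> k\<close>, which stays bounded after multiplication by
  \<open>\<sigma> (Suc k)\<close>. The weight \<open>\<gamma> 0\<close>, missing from the proximal
  sequence, is handled separately.\<close>

lemma excess_bound:
  assumes lower: "\<And>k. u \<bullet> p k - c \<le> H k"
  obtains B where "\<And>k. \<sigma> (Suc k) * ((norm (v k))\<^sup>2 - (norm u)\<^sup>2) \<le> B"
proof -
  obtain M where M: "M \<ge> 0" "\<And>k. norm (q k) \<le> M" using q_bounded by blast
  obtain b where b: "\<And>k. \<sigma> (Suc k) * \<delta> k \<le> b" using \<delta>_\<sigma>_bounded by blast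
  obtain D where D: "\<And>k. \<delta> k \<le> D" using \<delta>_bounded by blast
  obtain B where B: "\<And>k. (\<Sum>i<k. \<gamma> (Suc i)) * ((norm (q k))\<^sup>2 - (norm u)\<^sup>2) \<le> B"
    using weighted_excess_bound[OF summable_\<epsilon> M summable_ratio_tail lower]
    by blast
  have "\<sigma> (Suc k) * ((norm (v k))\<^sup>2 - (norm u)\<^sup>2) \<le> \<gamma> 0 * M\<^sup>2 + B + (2 * M + D) * b" for k
  proof -
    have "norm (v k) \<le> norm (q k) + \<delta> k"
      using near[of k] norm_triangle_sub[of "v k" "q k"] by (simp add: \<delta>_def)
    then have "(norm (v k))\<^sup>2 \<le> (norm (q k) + \<delta> k)\<^sup>2" by (simp add: power_mono)
    also have "\<dots> = (norm (q k))\<^sup>2 + (2 * norm (q k) + \<delta> k) * \<delta> k"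
      by (simp add: power2_eq_square algebra_simps)
    also have "\<dots> \<le> (norm (q k))\<^sup>2 + (2 * M + D) * \<delta> k"
      using M(2)[of k] D[of k] \<delta>_nonneg[of k] by (intro add_left_mono mult_right_mono) auto
    finally have "(norm (v k))\<^sup>2 - (norm u)\<^sup>2 \<le> (norm (q k))\<^sup>2 - (norm u)\<^sup>2 + (2 * M + D) * \<delta> k"
      by simp
    then have "\<sigma> (Suc k) * ((norm (v k))\<^sup>2 - (norm u)\<^sup>2)
        \<le> \<sigma> (Suc k) * ((norm (q k))\<^sup>2 - (norm u)\<^sup>2 + (2 * M + D) * \<delta> k)"
      using \<sigma>_Suc_pos[of k] by (intro mult_left_mono) auto
    also have "\<dots> = \<gamma> 0 * ((norm (q k))\<^sup>2 - (norm u)\<^sup>2) +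
        (\<Sum>i<k. \<gamma> (Suc i)) * ((norm (q k))\<^sup>2 - (norm u)\<^sup>2) + (2 * M + D) * (\<sigma> (Suc k) * \<delta> k)"
      unfolding \<sigma>_Suc by (simp add: algebra_simps)
    also have "\<dots> \<le> \<gamma> 0 * M\<^sup>2 + B + (2 * M + D) * b"
    proof (intro add_mono mult_left_mono B b)
      have "(norm (q k))\<^sup>2 \<le> M\<^sup>2" using M by (simp add: power_mono)
      then show "(norm (q k))\<^sup>2 - (norm u)\<^sup>2 \<le> M\<^sup>2" using zero_le_power2[of "norm u"] by linarith
      show "0 \<le> 2 * M + D" using M(1) D[of 0] \<delta>_nonneg[of 0] by linarith
    qed (use \<gamma>_pos[of 0] in simp)
    finally show ?thesis .
  qed
  then show ?thesis using that by blast
qed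

lemma v_attained: "v k \<in> fst ` W"
  using iterate[of k] by force

text \<open>Reduces convergence of \<open>v\<close> to convergence of its norms.\<close>

lemma v_excess: "(norm (v k - sbar))\<^sup>2 \<le> (norm (v k))\<^sup>2 - (norm sbar)\<^sup>2"
  using sbar_minimal[OF subsetD[OF closure_subset v_attained], of k] by simp

lemma excess_nonneg: "0 \<le> (norm (v k))\<^sup>2 - (norm sbar)\<^sup>2"
  using v_excess zero_le_power2 order_trans by blast

text \<open>The conjugate may be infinite at \<open>sbar\<close>. A nearby attained violation
  \<open>fst w\<close> is used instead: \<open>snd w\<close> bounds the conjugate there, so its
  excess bound applies. Half of \<open>a\<close> pays for the replacement, half for the bound
  divided by \<open>\<sigma> (Suc k)\<close>.\<close>

lemma excess_tendsto_0: "(\<lambda>k. (norm (v k))\<^sup>2 - (norm sbar)\<^sup>2) \<longlonglongrightarrow> 0"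
proof (rule order_tendstoI)
  show "\<forall>\<^sub>F k in sequentially. a < (norm (v k))\<^sup>2 - (norm sbar)\<^sup>2" if "a < 0" for a
    using excess_nonneg that less_le_trans by (intro always_eventually) blast
next
  fix a :: real assume a: "0 < a"
  have "((\<lambda>z. (norm z)\<^sup>2) \<longlongrightarrow> (norm sbar)\<^sup>2) (nhds sbar)"
    by (intro tendsto_intros filterlim_ident)
  then have "\<forall>\<^sub>F z in nhds sbar. (norm z)\<^sup>2 < (norm sbar)\<^sup>2 + a / 2"
    using a by (intro order_tendstoD) auto
  then obtain U where U: "open U" "sbar \<in> U" "\<And>z. z \<in> U \<Longrightarrow> (norm z)\<^sup>2 < (norm sbar)\<^sup>2 + a / 2"
    unfolding eventually_nhds by blast
  then obtain w where w: "w \<in> W" "fst w \<in> U"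
    using sbar_closure unfolding closure_iff_nhds_not_empty by blast
  obtain B where B: "\<And>k. \<sigma> (Suc k) * ((norm (v k))\<^sup>2 - (norm (fst w))\<^sup>2) \<le> B"
    using excess_bound[of "fst w" "snd w"] upper[OF w(1)]
    unfolding p_def by (auto simp: inner_commute)
  have "\<forall>\<^sub>F k in sequentially. \<sigma> k > 2 * B / a"
    using \<sigma>_at_top by (simp add: filterlim_at_top_dense)
  then have "\<forall>\<^sub>F k in sequentially. \<sigma> (Suc k) > 2 * B / a"
    by (rule eventually_compose_filterlim[OF _ filterlim_Suc])
  then show "\<forall>\<^sub>F k in sequentially. (norm (v k))\<^sup>2 - (norm sbar)\<^sup>2 < a"
  proof eventually_elim
    case (elim k)
    have "\<sigma> (Suc k) * ((norm (v k))\<^sup>2 - (norm (fst w))\<^sup>2) < \<sigma> (Suc k) * (a / 2)"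
      using B[of k] elim a by (simp add: field_simps)
    then have "(norm (v k))\<^sup>2 - (norm (fst w))\<^sup>2 < a / 2"
      using \<sigma>_Suc_pos[of k] by simp
    then show ?case using U(3)[OF w(2)] by simp
  qed
qed

text \<open>The energy bound at \<open>sbar\<close> controls the proximal points; passing to
  \<open>v\<close> adds terms of order \<open>\<gamma> k * (\<delta> k)\<^sup>2 = \<delta> k *
  \<epsilon> (Suc k)\<close>, which are summable because \<open>\<delta>\<close> is bounded.\<close>

lemma summable_distance:
  assumes lower: "\<And>k. sbar \<bullet> p k - c \<le> H k"
  shows "summable (\<lambda>k. \<gamma> k * (norm (v k - sbar))\<^sup>2)"
proof -
  obtain M where M: "M \<ge> 0" "\<And>k. norm (q k) \<le> M" using q_bounded by blast
  obtain D where D: "\<And>k. \<delta> k \<le> D" using \<delta>_bounded by blast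
  obtain B where B: "\<And>k. (\<Sum>j<k. \<gamma> (Suc j) * ((q (Suc j) - sbar) \<bullet> q (Suc j))) \<le> B"
    using energy_bound[OF summable_\<epsilon> M lower] by blast
  have "summable (\<lambda>k. \<gamma> (Suc k) * (norm (q (Suc k) - sbar))\<^sup>2)"
  proof (rule summableI_nonneg_bounded)
    show "0 \<le> \<gamma> (Suc k) * (norm (q (Suc k) - sbar))\<^sup>2" for k using \<gamma>_pos[of "Suc k"] by simp
    fix k
    \<comment> \<open>Minimality of \<open>sbar\<close> gives
      \<open>sbar \<bullet> (q j - sbar) \<ge> 0\<close>.\<close>
    have "(norm (q j - sbar))\<^sup>2 \<le> (q j - sbar) \<bullet> q j" for j
      using sbar_minimal[OF q_closure[of j]]
      by (simp add: power2_norm_eq_inner inner_diff_left inner_diff_right inner_commute)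
    then have "(\<Sum>j<k. \<gamma> (Suc j) * (norm (q (Suc j) - sbar))\<^sup>2)
        \<le> (\<Sum>j<k. \<gamma> (Suc j) * ((q (Suc j) - sbar) \<bullet> q (Suc j)))"
      using \<gamma>_pos by (intro sum_mono mult_left_mono) (auto simp: less_imp_le)
    then show "(\<Sum>j<k. \<gamma> (Suc j) * (norm (q (Suc j) - sbar))\<^sup>2) \<le> B" using B[of k] by linarith
  qed
  moreover have "summable (\<lambda>k. \<epsilon> (Suc (Suc k)))"
    using summable_\<epsilon> by (simp only: summable_Suc_iff[of "\<lambda>k. \<epsilon> (Suc k)"])
  ultimately have dominating: "summable (\<lambda>k. 2 * (\<gamma> (Suc k) * (norm (q (Suc k) - sbar))\<^sup>2) + 2 * D * \<epsilon> (Suc (Suc k)))"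
    by (intro summable_add summable_mult)
  have "summable (\<lambda>k. \<gamma> (Suc k) * (norm (v (Suc k) - sbar))\<^sup>2)"
  proof (rule summable_comparison_test'[OF dominating])
    fix k
    let ?k = "Suc k"
    have "norm (v ?k - sbar) \<le> norm (q ?k - sbar) + \<delta> ?k"
      using near[of ?k] norm_triangle_ineq[of "v ?k - q ?k" "q ?k - sbar"] by (simp add: \<delta>_def)
    then have "(norm (v ?k - sbar))\<^sup>2 \<le> (norm (q ?k - sbar) + \<delta> ?k)\<^sup>2" by (simp add: power_mono)
    also have "\<dots> \<le> 2 * (norm (q ?k - sbar))\<^sup>2 + 2 * (\<delta> ?k)\<^sup>2"
      using zero_le_power2[of "norm (q ?k - sbar) - \<delta> ?k"] by (simp add: power2_eq_square algebra_simps)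
    finally have "\<gamma> ?k * (norm (v ?k - sbar))\<^sup>2 \<le> \<gamma> ?k * (2 * (norm (q ?k - sbar))\<^sup>2 + 2 * (\<delta> ?k)\<^sup>2)"
      using \<gamma>_pos[of ?k] by simp
    also have "\<dots> = 2 * (\<gamma> ?k * (norm (q ?k - sbar))\<^sup>2) + 2 * (\<delta> ?k * (\<gamma> ?k * \<delta> ?k))"
      by (simp add: power2_eq_square algebra_simps)
    also have "\<gamma> ?k * \<delta> ?k = \<epsilon> (Suc ?k)" using \<gamma>_pos[of ?k] by (simp add: \<delta>_def)
    also have "2 * (\<gamma> ?k * (norm (q ?k - sbar))\<^sup>2) + 2 * (\<delta> ?k * \<epsilon> (Suc ?k))
        \<le> 2 * (\<gamma> ?k * (norm (q ?k - sbar))\<^sup>2) + 2 * D * \<epsilon> (Suc ?k)"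
      using mult_right_mono[OF D \<epsilon>_nonneg, of ?k ?k] by simp
    finally show "norm (\<gamma> ?k * (norm (v ?k - sbar))\<^sup>2)
        \<le> 2 * (\<gamma> ?k * (norm (q ?k - sbar))\<^sup>2) + 2 * D * \<epsilon> (Suc ?k)"
      using \<gamma>_pos[of ?k] by simp
  qed
  then show ?thesis by (rule iffD1[OF summable_Suc_iff])
qed

lemma multiplier_inner_le:
  "l k \<bullet> (v j - sbar) \<le> norm (l 0) * norm (v j - sbar)
     + (\<Sum>i<k. \<gamma> i * norm (v i - sbar)) * norm (v j - sbar)"
proof (induction k)
  case 0
  show ?case by (simp add: norm_cauchy_schwarz)
next
  case (Suc k)
  have "sbar \<bullet> (v j - sbar) \<ge> 0"
    using v_excess[of j] by (simp add: power2_norm_eq_inner inner_diff_left inner_diff_right inner_commute)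
  moreover have "- ((v k - sbar) \<bullet> (v j - sbar)) \<le> norm (v k - sbar) * norm (v j - sbar)"
    using norm_cauchy_schwarz[of "- (v k - sbar)" "v j - sbar"] by (simp only: inner_minus_left norm_minus_cancel)
  moreover have "v k \<bullet> (v j - sbar) = (v k - sbar) \<bullet> (v j - sbar) + sbar \<bullet> (v j - sbar)"
    by (simp add: inner_diff_left)
  ultimately have "- (v k \<bullet> (v j - sbar)) \<le> norm (v k - sbar) * norm (v j - sbar)" by linarith
  then have "\<gamma> k * - (v k \<bullet> (v j - sbar)) \<le> \<gamma> k * (norm (v k - sbar) * norm (v j - sbar))"
    using \<gamma>_pos[of k] by (intro mult_left_mono) auto
  moreover have "l (Suc k) \<bullet> (v j - sbar) = l k \<bullet> (v j - sbar) + \<gamma> k * - (v k \<bullet> (v j - sbar))"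
    unfolding multiplier inner_diff_left[of "l k"] inner_scaleR_left by simp
  ultimately show ?case using Suc by (simp add: algebra_simps)
qed

text \<open>Inserting \<open>lower\<close> into \<open>gap\<close> completes the square of
  \<open>norm (q k - sbar)\<close>; this square and the excess of \<open>v k\<close> enter with a
  negative sign and are discarded.\<close>

lemma value_le:
  assumes lower: "\<And>k. sbar \<bullet> p k - c \<le> H k"
  shows "r k \<le> c + l k \<bullet> (v k - sbar) + \<delta> k * \<epsilon> (Suc k) / 2"
proof -
  have "0 \<le> \<gamma> k / 2 * (norm (q k - sbar))\<^sup>2" using \<gamma>_pos[of k] by simp
  moreover have "(norm (q k - sbar))\<^sup>2 = (norm (q k))\<^sup>2 - 2 * (sbar \<bullet> q k) + (norm sbar)\<^sup>2"
    by (simp add: power2_norm_eq_inner inner_diff_left inner_diff_right inner_commute)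
  moreover have "0 \<le> \<gamma> k / 2 * ((norm (v k))\<^sup>2 - (norm sbar)\<^sup>2)"
    using excess_nonneg \<gamma>_pos[of k] by simp
  moreover have "sbar \<bullet> l k - \<gamma> k * (sbar \<bullet> q k) - c \<le> H k"
    using lower[of k] by (simp add: p_def inner_diff_right)
  moreover have "r k - l k \<bullet> v k + \<gamma> k / 2 * (norm (v k))\<^sup>2
      \<le> - H k - \<gamma> k / 2 * (norm (q k))\<^sup>2 + \<delta> k * \<epsilon> (Suc k) / 2"
    using gap[of k] by (simp add: augmented_def \<delta>_def power2_eq_square)
  ultimately show ?thesis by (simp add: inner_diff_right inner_commute algebra_simps)
qed

text \<open>In the bound on the multiplier term, the rate replaces the last factor by a multiple of
  \<open>1 / sqrt (\<sigma> k)\<close>, so the normalized weighted sum of the distances appears, and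
  this tends to 0.\<close>

lemma value_upper_limit:
  assumes lower: "\<And>k. sbar \<bullet> p k - c \<le> H k"
  obtains R where "R \<longlonglongrightarrow> c" "\<forall>\<^sub>F k in sequentially. r k \<le> R k"
proof -
  define d where "d k = norm (v k - sbar)" for k
  obtain B where B: "\<And>k. \<sigma> (Suc k) * ((norm (v k))\<^sup>2 - (norm sbar)\<^sup>2) \<le> B"
    using excess_bound[OF lower] by blast
  obtain D where D: "\<And>k. \<delta> k \<le> D" using \<delta>_bounded by blast
  \<comment> \<open>Stated with \<open>\<sigma> k\<close> instead of \<open>\<sigma> (Suc k)\<close>
    to match the sum over \<open>i < k\<close>; positivity of \<open>\<sigma> k\<close> then
    requires \<open>k > 0\<close>.\<close>
  have d_le: "d k \<le> sqrt B / sqrt (\<sigma> k)" if "k > 0" for k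
  proof -
    have pos: "\<sigma> k > 0" using that \<sigma>_Suc_pos[of "k - 1"] by simp
    have "\<sigma> k * (d k)\<^sup>2 \<le> \<sigma> (Suc k) * (d k)\<^sup>2"
      using \<gamma>_pos[of k] by (intro mult_right_mono) (auto simp: \<sigma>_def)
    also have "\<dots> \<le> \<sigma> (Suc k) * ((norm (v k))\<^sup>2 - (norm sbar)\<^sup>2)"
      using v_excess[of k] \<sigma>_Suc_pos[of k] by (intro mult_left_mono) (auto simp: d_def)
    also have "\<dots> \<le> B" by (rule B)
    finally have "(d k)\<^sup>2 \<le> B / \<sigma> k" using pos by (simp add: field_simps)
    then show ?thesis by (simp add: real_le_rsqrt flip: real_sqrt_divide)
  qed
  define R where "R k = c + norm (l 0) * d k
      + sqrt B * ((\<Sum>i<k. \<gamma> i * d i) / sqrt (\<Sum>i<k. \<gamma> i)) + D * \<epsilon> (Suc k) / 2" for k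
  have "d \<longlonglongrightarrow> 0"
  proof (rule tendsto_sandwich[of "\<lambda>_. 0" d])
    show "(\<lambda>k. sqrt ((norm (v k))\<^sup>2 - (norm sbar)\<^sup>2)) \<longlonglongrightarrow> 0"
      using tendsto_real_sqrt[OF excess_tendsto_0] by simp
    show "\<forall>\<^sub>F k in sequentially. d k \<le> sqrt ((norm (v k))\<^sup>2 - (norm sbar)\<^sup>2)"
      using v_excess by (simp add: d_def real_le_rsqrt)
  qed (auto simp: d_def)
  moreover have "(\<lambda>k. (\<Sum>i<k. \<gamma> i * d i) / sqrt (\<Sum>i<k. \<gamma> i)) \<longlonglongrightarrow> 0"
    using \<gamma>_pos summable_distance[OF lower] \<sigma>_at_top
    by (intro weighted_sum_over_sqrt_tendsto_0) (auto simp: d_def \<sigma>_def[abs_def])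
  moreover have "(\<lambda>k. \<epsilon> (Suc k)) \<longlonglongrightarrow> 0" by (rule summable_LIMSEQ_zero[OF summable_\<epsilon>])
  ultimately have "R \<longlonglongrightarrow> c + norm (l 0) * 0 + sqrt B * 0 + D * 0 / 2"
    unfolding R_def by (intro tendsto_intros) auto
  then have "R \<longlonglongrightarrow> c" by simp
  moreover have "r k \<le> R k" if "k > 0" for k
  proof -
    have "r k \<le> c + l k \<bullet> (v k - sbar) + \<delta> k * \<epsilon> (Suc k) / 2" by (rule value_le[OF lower])
    moreover have "\<delta> k * \<epsilon> (Suc k) \<le> D * \<epsilon> (Suc k)" by (rule mult_right_mono[OF D \<epsilon>_nonneg])
    moreover have "l k \<bullet> (v k - sbar) \<le> norm (l 0) * d k + (\<Sum>i<k. \<gamma> i * d i) * d k"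
      using multiplier_inner_le by (simp add: d_def)
    moreover have "(\<Sum>i<k. \<gamma> i * d i) * d k \<le> (\<Sum>i<k. \<gamma> i * d i) * (sqrt B / sqrt (\<sigma> k))"
      using \<gamma>_pos d_le[OF that] by (intro mult_left_mono sum_nonneg) (auto simp: d_def less_imp_le)
    moreover have "\<dots> = sqrt B * ((\<Sum>i<k. \<gamma> i * d i) / sqrt (\<Sum>i<k. \<gamma> i))"
      by (simp add: \<sigma>_def)
    ultimately show ?thesis unfolding R_def by linarith
  qed
  then have "\<forall>\<^sub>F k in sequentially. r k \<le> R k"
    by (rule eventually_mono[OF eventually_gt_at_top])
  ultimately show ?thesis using that by blast
qed

end

section \<open>The constrained problem as a convex set of violations and values\<close>

text \<open>With \<open>r\<close> real, points where \<open>f\<close> is infinite contribute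
  nothing, and the first coordinates are exactly the attainable violations.\<close>

definition violation_epigraph ::
  "'a set \<Rightarrow> 'b::real_vector set \<Rightarrow> ('a \<Rightarrow> 'b) \<Rightarrow> ('a \<Rightarrow> ereal) \<Rightarrow> ('b \<times> real) set" where
  "violation_epigraph X K C f = {(s, r). \<exists>x. (x, s) \<in> violation_graph X K C \<and> f x \<le> ereal r}"

lemma violation_epigraphI:
  "(x, s) \<in> violation_graph X K C \<Longrightarrow> f x \<le> ereal r \<Longrightarrow> (s, r) \<in> violation_epigraph X K C f"
  by (auto simp: violation_epigraph_def)

lemma violation_epigraphE:
  assumes "w \<in> violation_epigraph X K C f"
  obtains x where "(x, fst w) \<in> violation_graph X K C" "f x \<le> ereal (snd w)"
  using assms by (auto simp: violation_epigraph_def)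

lemma in_violation_graph_imp_in_domain: "(x, s) \<in> violation_graph X K C \<Longrightarrow> x \<in> X"
  by (auto simp: violation_graph_def)

lemma fst_violation_epigraph:
  "fst ` violation_epigraph X K C f = attainable_violations X K C f"
proof (intro subset_antisym subsetI)
  fix s assume "s \<in> fst ` violation_epigraph X K C f"
  then obtain w where "w \<in> violation_epigraph X K C f" "s = fst w" by blast
  then obtain x where "(x, s) \<in> violation_graph X K C" "f x \<le> ereal (snd w)"
    by (metis violation_epigraphE)
  then show "s \<in> attainable_violations X K C f"
    unfolding attainable_violations_def
    using in_violation_graph_imp_in_domain le_less_trans[of "f x" "ereal (snd w)" \<infinity>] by fastforce
next
  fix s assume "s \<in> attainable_violations X K C f"
  then obtain x where x: "f x < \<infinity>" "(x, s) \<in> violation_graph X K C"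
    unfolding attainable_violations_def by blast
  obtain r where "f x \<le> ereal r" using x(1) by (cases "f x") auto
  then show "s \<in> fst ` violation_epigraph X K C f"
    using violation_epigraphI[OF x(2)] by force
qed

lemma convex_violation_epigraph:
  assumes "convex (violation_graph X K C)" "ereal_convex_on X f"
  shows "convex (violation_epigraph X K C f)"
proof (unfold convex_alt, intro ballI allI impI)
  fix w w' :: "'b \<times> real" and t :: real
  assume w: "w \<in> violation_epigraph X K C f" "w' \<in> violation_epigraph X K C f" and t: "0 \<le> t \<and> t \<le> 1"
  obtain x where x: "(x, fst w) \<in> violation_graph X K C" "f x \<le> ereal (snd w)"
    using w(1) by (rule violation_epigraphE)
  obtain x' where x': "(x', fst w') \<in> violation_graph X K C" "f x' \<le> ereal (snd w')"
    using w(2) by (rule violation_epigraphE)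
  have "(1 - t) *\<^sub>R (x, fst w) + t *\<^sub>R (x', fst w') \<in> violation_graph X K C"
    using t by (intro convexD[OF assms(1) x(1) x'(1)]) auto
  then have graph: "((1 - t) *\<^sub>R x + t *\<^sub>R x', (1 - t) *\<^sub>R fst w + t *\<^sub>R fst w') \<in> violation_graph X K C"
    by simp
  have "f ((1 - t) *\<^sub>R x + t *\<^sub>R x') \<le> ereal (1 - t) * f x + ereal t * f x'"
    using t in_violation_graph_imp_in_domain[OF x(1)] in_violation_graph_imp_in_domain[OF x'(1)]
    by (intro assms(2)[unfolded ereal_convex_on_def, rule_format]) auto
  also have "\<dots> \<le> ereal (1 - t) * ereal (snd w) + ereal t * ereal (snd w')"
    using x(2) x'(2) t by (intro add_mono ereal_mult_left_mono) auto
  finally have "f ((1 - t) *\<^sub>R x + t *\<^sub>R x') \<le> ereal ((1 - t) * snd w + t * snd w')" by simp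
  with graph have "((1 - t) *\<^sub>R fst w + t *\<^sub>R fst w', (1 - t) * snd w + t * snd w')
      \<in> violation_epigraph X K C f"
    by (rule violation_epigraphI)
  then show "(1 - t) *\<^sub>R w + t *\<^sub>R w' \<in> violation_epigraph X K C f"
    by (simp add: scaleR_prod_def plus_prod_def)
qed

text \<open>Translates the supremum in \<open>ereal\<close> into real inequalities over the
  epigraph, the form of \<open>upper\<close> and \<open>least\<close>.\<close>

lemma neg_dual_le_iff:
  assumes "\<And>x. x \<in> X \<Longrightarrow> f x \<noteq> -\<infinity>"
  shows "neg_dual X K C f m \<le> ereal G \<longleftrightarrow>
    (\<forall>w\<in>violation_epigraph X K C f. m \<bullet> fst w - snd w \<le> G)"
proof
  assume le: "neg_dual X K C f m \<le> ereal G"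
  show "\<forall>w\<in>violation_epigraph X K C f. m \<bullet> fst w - snd w \<le> G"
  proof
    fix w assume "w \<in> violation_epigraph X K C f"
    then obtain x where x: "(x, fst w) \<in> violation_graph X K C" "f x \<le> ereal (snd w)"
      by (rule violation_epigraphE)
    have "ereal (m \<bullet> fst w) - f x \<le> neg_dual X K C f m"
      unfolding neg_dual_def using x(1) by (intro SUP_upper2[of "(x, fst w)"]) auto
    then have "ereal (m \<bullet> fst w) - f x \<le> ereal G" using le by (rule order_trans)
    then show "m \<bullet> fst w - snd w \<le> G"
      using x(2) assms[OF in_violation_graph_imp_in_domain[OF x(1)]] by (cases "f x") auto
  qed
next
  assume le: "\<forall>w\<in>violation_epigraph X K C f. m \<bullet> fst w - snd w \<le> G"
  have "ereal (m \<bullet> s) - f x \<le> ereal G" if xs: "(x, s) \<in> violation_graph X K C" for x s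
  proof (cases "f x")
    case (real r)
    then have "(s, r) \<in> violation_epigraph X K C f" using violation_epigraphI[OF xs] by simp
    then show ?thesis using le real by force
  qed (use assms[OF in_violation_graph_imp_in_domain[OF xs]] in auto)
  then show "neg_dual X K C f m \<le> ereal G"
    unfolding neg_dual_def by (auto intro!: SUP_least)
qed

text \<open>A direction \<open>m\<close> nearly attaining the conjugate has a finite negative dual:
  \<open>-\<infinity>\<close> is impossible over a nonempty epigraph, and \<open>\<infinity>\<close>
  would make the difference \<open>-\<infinity>\<close>.\<close>

lemma less_conjugate_neg_dual:
  assumes f: "\<And>x. x \<in> X \<Longrightarrow> f x \<noteq> -\<infinity>" and W: "violation_epigraph X K C f \<noteq> {}"
    and less: "b < conjugate (neg_dual X K C f) s"
  obtains m G where "neg_dual X K C f m = ereal G" "b < ereal (s \<bullet> m - G)"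
proof -
  obtain m where m: "b < ereal (s \<bullet> m) - neg_dual X K C f m"
    using less unfolding conjugate_def less_SUP_iff by blast
  obtain w where w: "w \<in> violation_epigraph X K C f" using W by blast
  have "neg_dual X K C f m \<noteq> -\<infinity>"
  proof
    assume inf: "neg_dual X K C f m = -\<infinity>"
    then have "neg_dual X K C f m \<le> ereal (m \<bullet> fst w - snd w - 1)" by simp
    then show False using w neg_dual_le_iff[of X f K C m, OF f] by force
  qed
  then obtain G where "neg_dual X K C f m = ereal G"
    using m by (cases "neg_dual X K C f m") auto
  then show ?thesis using that m by simp
qed

text \<open>The growth inequality serves twice. At \<open>(s, r)\<close> it bounds the distance to
  \<open>q\<close> by the optimality gap. At a general \<open>w\<close> the quadratic terms in
  \<open>fst w\<close> cancel, which leaves the affine bound \<open>H\<close>.\<close>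

lemma inexact_minimizer_near_proximal_point:
  fixes K :: "'b::{real_inner, complete_space} set"
  assumes f: "proper_on X f" "ereal_convex_on X f" and graph: "convex (violation_graph X K C)"
    and xs: "(x, s) \<in> violation_graph X K C" and \<gamma>: "\<gamma> > 0" and \<epsilon>: "\<epsilon> \<ge> 0"
    and K: "K \<noteq> {}"
    and gap: "aug_lagrangian f \<gamma> x s l
          - (INF (u, t)\<in>violation_graph X K C. aug_lagrangian f \<gamma> u t l) \<le> ereal (\<epsilon>\<^sup>2 / (2 * \<gamma>))"
  defines "W \<equiv> violation_epigraph X K C f"
  obtains r q H where "f x = ereal r" "norm (s - q) \<le> \<epsilon> / \<gamma>" "q \<in> closure (fst ` W)"
    "\<And>w. w \<in> W \<Longrightarrow> (l - \<gamma> *\<^sub>R q) \<bullet> fst w - snd w \<le> H"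
    "\<And>m G. (\<And>w. w \<in> W \<Longrightarrow> m \<bullet> fst w - snd w \<le> G) \<Longrightarrow> H + q \<bullet> (m - (l - \<gamma> *\<^sub>R q)) \<le> G"
    "augmented l \<gamma> (s, r) \<le> - H - \<gamma> / 2 * (norm q)\<^sup>2 + \<epsilon>\<^sup>2 / (2 * \<gamma>)"
proof -
  define J where "J = (INF (u, t)\<in>violation_graph X K C. aug_lagrangian f \<gamma> u t l)"
  have not_minf: "u \<in> X \<Longrightarrow> f u \<noteq> -\<infinity>" for u using f(1) by (simp add: proper_on_def)
  have x: "f x \<noteq> -\<infinity>" using not_minf xs in_violation_graph_imp_in_domain by metis
  obtain u0 where u0: "u0 \<in> X" "f u0 < \<infinity>" using f(1) by (auto simp: proper_on_def)
  obtain y0 where "y0 \<in> K" using K by blast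
  then have "(u0, C u0 - y0) \<in> violation_graph X K C" using u0 by (auto simp: violation_graph_def)
  then have "J \<le> aug_lagrangian f \<gamma> u0 (C u0 - y0) l"
    unfolding J_def by (intro INF_lower2[of "(u0, C u0 - y0)"]) auto
  also have "\<dots> < \<infinity>" using u0(2) not_minf[OF u0(1)] by (cases "f u0") (auto simp: aug_lagrangian_def)
  finally have "J \<noteq> \<infinity>" by simp
  \<comment> \<open>Subtracting \<open>-\<infinity>\<close> would make the gap infinite; likewise,
    for finite \<open>J\<close>, an infinite \<open>f x\<close> is excluded next.\<close>
  moreover have "J \<noteq> -\<infinity>"
    using gap x unfolding J_def[symmetric] by (cases "f x") (auto simp: aug_lagrangian_def)
  ultimately obtain I where I: "J = ereal I" by (cases J) auto
  then obtain r where r: "f x = ereal r"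
    using gap x unfolding J_def[symmetric] by (cases "f x") (auto simp: aug_lagrangian_def)
  have near: "augmented l \<gamma> (s, r) \<le> I + \<epsilon>\<^sup>2 / (2 * \<gamma>)"
    using gap unfolding J_def[symmetric] I by (simp add: aug_lagrangian_def r augmented_def)
  have lower: "I \<le> augmented l \<gamma> w" if "w \<in> W" for w
  proof -
    obtain u where u: "(u, fst w) \<in> violation_graph X K C" "f u \<le> ereal (snd w)"
      using \<open>w \<in> W\<close> unfolding W_def by (rule violation_epigraphE)
    have "J \<le> aug_lagrangian f \<gamma> u (fst w) l"
      unfolding J_def using u(1) by (intro INF_lower2[of "(u, fst w)"]) auto
    then show ?thesis using u(2) not_minf[OF in_violation_graph_imp_in_domain[OF u(1)]]
      unfolding I by (cases "f u") (auto simp: aug_lagrangian_def augmented_def)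
  qed
  have approx: "\<exists>w\<in>W. augmented l \<gamma> w < I + d" if "d > 0" for d
  proof -
    have "J < ereal (I + d)" using that I by simp
    then obtain u t where u: "(u, t) \<in> violation_graph X K C" "aug_lagrangian f \<gamma> u t l < ereal (I + d)"
      unfolding J_def INF_less_iff by auto
    obtain r' where r': "f u = ereal r'"
      using u(2) not_minf[OF in_violation_graph_imp_in_domain[OF u(1)]]
      by (cases "f u") (auto simp: aug_lagrangian_def)
    then have "(t, r') \<in> W" using violation_epigraphI[OF u(1)] by (simp add: W_def)
    moreover have "augmented l \<gamma> (t, r') < I + d"
      using u(2) by (simp add: aug_lagrangian_def r' augmented_def)
    ultimately show ?thesis by blast
  qed
  have "convex W" unfolding W_def by (rule convex_violation_epigraph[OF graph f(2)])
  then obtain q z where z: "\<And>n::nat. z n \<in> W" and q: "(\<lambda>n. fst (z n)) \<longlonglongrightarrow> q"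
    and lim: "(\<lambda>n. augmented l \<gamma> (z n)) \<longlonglongrightarrow> I"
    and growth: "\<And>w. w \<in> W \<Longrightarrow> I + \<gamma> / 2 * (norm (fst w - q))\<^sup>2 \<le> augmented l \<gamma> w"
    by (rule proximal_point_exists[OF _ \<gamma> lower approx]) (assumption+, rule that)
  define H where "H = - I - \<gamma> / 2 * (norm q)\<^sup>2"
  show ?thesis
  proof
    show "f x = ereal r" by (fact r)
    have "(s, r) \<in> W" unfolding W_def using r by (intro violation_epigraphI[OF xs]) simp
    then have "\<gamma> / 2 * (norm (s - q))\<^sup>2 \<le> \<epsilon>\<^sup>2 / (2 * \<gamma>)" using growth[of "(s, r)"] near by simp
    then have "(norm (s - q))\<^sup>2 \<le> (\<epsilon> / \<gamma>)\<^sup>2"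
      using \<gamma> by (simp add: field_simps power2_eq_square)
    then show "norm (s - q) \<le> \<epsilon> / \<gamma>" by (rule power2_le_imp_le) (use \<gamma> \<epsilon> in simp)
    show "q \<in> closure (fst ` W)" unfolding closure_sequential using z q
      by (intro exI[of _ "\<lambda>n. fst (z n)"]) auto
    show "(l - \<gamma> *\<^sub>R q) \<bullet> fst w - snd w \<le> H" if "w \<in> W" for w
      using growth[OF that]
      by (simp add: H_def augmented_def power2_norm_eq_inner inner_diff_left inner_diff_right
          inner_commute algebra_simps)
    show "augmented l \<gamma> (s, r) \<le> - H - \<gamma> / 2 * (norm q)\<^sup>2 + \<epsilon>\<^sup>2 / (2 * \<gamma>)"
      using near by (simp add: H_def)
    \<comment> \<open>The bound \<open>G\<close> is evaluated along the minimizing sequence and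
      passed to the limit.\<close>
    show "H + q \<bullet> (m - (l - \<gamma> *\<^sub>R q)) \<le> G"
      if G: "\<And>w. w \<in> W \<Longrightarrow> m \<bullet> fst w - snd w \<le> G" for m G
    proof (rule tendsto_upperbound)
      show "(\<lambda>n. (m - l) \<bullet> fst (z n) + \<gamma> / 2 * (norm (fst (z n)))\<^sup>2 - augmented l \<gamma> (z n))
          \<longlonglongrightarrow> H + q \<bullet> (m - (l - \<gamma> *\<^sub>R q))"
      proof -
        have "H + q \<bullet> (m - (l - \<gamma> *\<^sub>R q)) = (m - l) \<bullet> q + \<gamma> / 2 * (norm q)\<^sup>2 - I"
          by (simp add: H_def power2_norm_eq_inner inner_diff_left inner_diff_right inner_commute algebra_simps)
        then show ?thesis by (simp only:) (intro tendsto_intros q lim)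
      qed
      show "\<forall>\<^sub>F n in sequentially. (m - l) \<bullet> fst (z n) + \<gamma> / 2 * (norm (fst (z n)))\<^sup>2 - augmented l \<gamma> (z n) \<le> G"
        using G[OF z] by (intro always_eventually allI) (simp add: augmented_def inner_diff_left)
    qed simp
  qed
qed

section \<open>Limits and rates for the method\<close>

theorem theorem3p2:
  fixes X :: "'a::{real_inner, complete_space} set"
    and K :: "'b::{real_inner, complete_space} set"
    and C :: "'a \<Rightarrow> 'b"
    and f :: "'a \<Rightarrow> ereal"
    and \<gamma> \<epsilon> :: "nat \<Rightarrow> real"
    and x :: "nat \<Rightarrow> 'a"
    and y l s :: "nat \<Rightarrow> 'b"
  defines "h_conj \<equiv> conjugate (neg_dual X K C f)"
    and "sbar \<equiv> minimal_violation X K C f"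
  assumes "X \<noteq> {}" "closed X" "convex X"
    and "K \<noteq> {}" "closed K" "convex K"
    and "proper_on X f" "lower_semicontinuous_on X f" "ereal_convex_on X f"
    and "closed (violation_graph X K C)" "convex (violation_graph X K C)"
    and "\<And>t. value_fun X K C f t > -\<infinity>"
    and "error_step_conditions \<gamma> \<epsilon>"
    and "ialm X K C f \<gamma> \<epsilon> x y l s"
  shows "((\<lambda>k. C (x k) - y k) \<longlonglongrightarrow> sbar) \<and>
    ((\<lambda>k. norm (y k - metric_proj K (C (x k)))) \<longlonglongrightarrow> 0) \<and>
    h_conj sbar \<noteq> -\<infinity> \<and> ((\<lambda>k. f (x k)) \<longlonglongrightarrow> h_conj sbar) \<and>
    (h_conj sbar < \<infinity> \<longrightarrow>
      (\<lambda>k. norm (C (x k) - y k - sbar)) \<in> O(\<lambda>k. 1 / sqrt (\<Sum>i<k. \<gamma> i)) \<and>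
      (\<lambda>k. norm (y k - metric_proj K (C (x k)))) \<in> O(\<lambda>k. 1 / sqrt (\<Sum>i<k. \<gamma> i)))"
proof -
  note K = \<open>K \<noteq> {}\<close> \<open>closed K\<close> \<open>convex K\<close>
  note f = \<open>proper_on X f\<close> \<open>ereal_convex_on X f\<close>
  note graph = \<open>convex (violation_graph X K C)\<close>
  note conditions = \<open>error_step_conditions \<gamma> \<epsilon>\<close>
  define W where "W = violation_epigraph X K C f"
  \<comment> \<open>The shift skips the arbitrary initial entries \<open>x 0\<close> and
    \<open>y 0\<close>.\<close>
  define v where "v k = C (x (Suc k)) - y (Suc k)" for k
  have not_minf: "u \<in> X \<Longrightarrow> f u \<noteq> -\<infinity>" for u using f(1) by (simp add: proper_on_def)
  note ialm = \<open>ialm X K C f \<gamma> \<epsilon> x y l s\<close>[unfolded ialm_def, rule_format]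
  have xK: "x (Suc k) \<in> X" "y (Suc k) \<in> K" for k using ialm[of k] by auto
  have gap: "aug_lagrangian f (\<gamma> k) (x (Suc k)) (v k) (l k)
      - (INF (u, t)\<in>violation_graph X K C. aug_lagrangian f (\<gamma> k) u t (l k))
      \<le> ereal ((\<epsilon> (Suc k))\<^sup>2 / (2 * \<gamma> k))"
    and multiplier: "l (Suc k) = l k - \<gamma> k *\<^sub>R v k" for k
    using ialm[of k] by (auto simp: v_def)
  have xv: "(x (Suc k), v k) \<in> violation_graph X K C" for k
    using xK by (auto simp: violation_graph_def v_def)
  have pos: "\<gamma> k > 0" "\<epsilon> (Suc k) \<ge> 0" for k
    using conditions by (auto simp: error_step_conditions_def)
  have "\<forall>k. \<exists>r q H. f (x (Suc k)) = ereal r \<and> norm (v k - q) \<le> \<epsilon> (Suc k) / \<gamma> k \<and>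
    q \<in> closure (fst ` W) \<and>
    (\<forall>w\<in>W. (l k - \<gamma> k *\<^sub>R q) \<bullet> fst w - snd w \<le> H) \<and>
    (\<forall>m G. (\<forall>w\<in>W. m \<bullet> fst w - snd w \<le> G) \<longrightarrow> H + q \<bullet> (m - (l k - \<gamma> k *\<^sub>R q)) \<le> G) \<and>
    augmented (l k) (\<gamma> k) (v k, r) \<le> - H - \<gamma> k / 2 * (norm q)\<^sup>2 + (\<epsilon> (Suc k))\<^sup>2 / (2 * \<gamma> k)"
  proof
    fix k
    show "\<exists>r q H. f (x (Suc k)) = ereal r \<and> norm (v k - q) \<le> \<epsilon> (Suc k) / \<gamma> k \<and>
      q \<in> closure (fst ` W) \<and>
      (\<forall>w\<in>W. (l k - \<gamma> k *\<^sub>R q) \<bullet> fst w - snd w \<le> H) \<and>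
      (\<forall>m G. (\<forall>w\<in>W. m \<bullet> fst w - snd w \<le> G) \<longrightarrow> H + q \<bullet> (m - (l k - \<gamma> k *\<^sub>R q)) \<le> G) \<and>
      augmented (l k) (\<gamma> k) (v k, r) \<le> - H - \<gamma> k / 2 * (norm q)\<^sup>2 + (\<epsilon> (Suc k))\<^sup>2 / (2 * \<gamma> k)"
      by (rule inexact_minimizer_near_proximal_point[OF f graph xv pos K(1) gap, folded W_def])
         (intro exI conjI ballI allI impI; blast)
  qed
  then obtain r q H where r: "\<And>k. f (x (Suc k)) = ereal (r k)"
    and near: "\<And>k. norm (v k - q k) \<le> \<epsilon> (Suc k) / \<gamma> k"
    and q: "\<And>k. q k \<in> closure (fst ` W)"
    and upper: "\<And>k. \<forall>w\<in>W. (l k - \<gamma> k *\<^sub>R q k) \<bullet> fst w - snd w \<le> H k"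
    and least: "\<And>k. \<forall>m G. (\<forall>w\<in>W. m \<bullet> fst w - snd w \<le> G) \<longrightarrow> H k + q k \<bullet> (m - (l k - \<gamma> k *\<^sub>R q k)) \<le> G"
    and value_gap: "\<And>k. augmented (l k) (\<gamma> k) (v k, r k)
      \<le> - H k - \<gamma> k / 2 * (norm (q k))\<^sup>2 + (\<epsilon> (Suc k))\<^sup>2 / (2 * \<gamma> k)"
    by metis
  have iterate: "(v k, r k) \<in> W" for k
    unfolding W_def using r by (intro violation_epigraphI[OF xv]) simp
  have closure_W: "closure (fst ` W) = closure (attainable_violations X K C f)"
    by (simp add: W_def fst_violation_epigraph)
  have "convex (fst ` W)"
    unfolding W_def by (intro convex_linear_image linear_fst convex_violation_epigraph graph f)
  then have "convex (closure (fst ` W))" by (rule convex_closure)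
  note minimal = arg_min_dist_ineq[OF _ closed_closure this, where u = 0]
  \<comment> \<open>The point of minimal norm is the projection of the origin.\<close>
  have sbar_eq: "sbar = arg_min_on (\<lambda>z. dist 0 z) (closure (fst ` W))"
    by (simp add: sbar_def minimal_violation_def closure_W)
  have W_ne: "W \<noteq> {}" using iterate by blast
  then have ne: "closure (fst ` W) \<noteq> {}" by simp
  interpret inexact_augmented_lagrangian W \<gamma> \<epsilon> l v q r H sbar
  proof
    show "sbar \<in> closure (fst ` W)" using minimal(1)[OF ne] by (simp only: sbar_eq)
    show "(norm sbar)\<^sup>2 + (norm (z - sbar))\<^sup>2 \<le> (norm z)\<^sup>2" if "z \<in> closure (fst ` W)" for z
      using minimal(2)[OF ne that] by (simp add: sbar_eq)
  qed (use conditions multiplier iterate near q upper least value_gap in auto)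
  have proj_le: "(norm (y (Suc k) - metric_proj K (C (x (Suc k)))))\<^sup>2 \<le> (norm (v k))\<^sup>2 - (norm sbar)\<^sup>2" for k
  proof -
    define P where "P = metric_proj K (C (x (Suc k)))"
    have P: "P \<in> K" "(norm (P - C (x (Suc k))))\<^sup>2 + (norm (y (Suc k) - P))\<^sup>2 \<le> (norm (y (Suc k) - C (x (Suc k))))\<^sup>2"
      unfolding P_def metric_proj_def using arg_min_dist_ineq[OF K] xK by auto
    \<comment> \<open>Replacing \<open>y (Suc k)\<close> by the projection \<open>P\<close> gives
      another attainable violation, whose norm is therefore at least
      \<open>norm sbar\<close>.\<close>
    have "(x (Suc k), C (x (Suc k)) - P) \<in> violation_graph X K C"
      using xK P(1) by (auto simp: violation_graph_def)
    then have "(C (x (Suc k)) - P, r k) \<in> W"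
      unfolding W_def using r by (intro violation_epigraphI) auto
    then have "C (x (Suc k)) - P \<in> closure (fst ` W)"
      using closure_subset by force
    from sbar_minimal[OF this] have "(norm sbar)\<^sup>2 \<le> (norm (C (x (Suc k)) - P))\<^sup>2"
      using zero_le_power2 order_trans by (smt (verit))
    then show ?thesis using P(2)
      unfolding P_def[symmetric] v_def norm_minus_commute[of P] norm_minus_commute[of "y (Suc k)" "C (x (Suc k))"]
      by linarith
  qed
  \<comment> \<open>Used for both error sequences of the theorem: each is dominated by the excess of
    squared norms, with index shifted by one.\<close>
  have rate: "(\<lambda>k. norm (b k)) \<longlonglongrightarrow> 0 \<and>
      (\<forall>B. (\<forall>k. \<sigma> (Suc k) * ((norm (v k))\<^sup>2 - (norm sbar)\<^sup>2) \<le> B) \<longrightarrow>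
        (\<lambda>k. norm (b k)) \<in> O(\<lambda>k. 1 / sqrt (\<Sum>i<k. \<gamma> i)))"
    if b: "\<And>k. (norm (b (Suc k)))\<^sup>2 \<le> (norm (v k))\<^sup>2 - (norm sbar)\<^sup>2" for b :: "nat \<Rightarrow> 'b"
  proof (intro conjI allI impI)
    have "(\<lambda>k. norm (b (Suc k))) \<longlonglongrightarrow> 0"
    proof (rule tendsto_sandwich[of "\<lambda>_. 0" "\<lambda>k. norm (b (Suc k))"])
      show "(\<lambda>k. sqrt ((norm (v k))\<^sup>2 - (norm sbar)\<^sup>2)) \<longlonglongrightarrow> 0"
        using tendsto_real_sqrt[OF excess_tendsto_0] by simp
      show "\<forall>\<^sub>F k in sequentially. norm (b (Suc k)) \<le> sqrt ((norm (v k))\<^sup>2 - (norm sbar)\<^sup>2)"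
        using b by (simp add: real_le_rsqrt)
    qed auto
    then show "(\<lambda>k. norm (b k)) \<longlonglongrightarrow> 0" by (rule LIMSEQ_imp_Suc)
    fix B assume B: "\<forall>k. \<sigma> (Suc k) * ((norm (v k))\<^sup>2 - (norm sbar)\<^sup>2) \<le> B"
    have bound: "norm (b (Suc k)) \<le> sqrt B * (1 / sqrt (\<sigma> (Suc k)))" for k
    proof -
      have "\<sigma> (Suc k) * (norm (b (Suc k)))\<^sup>2 \<le> \<sigma> (Suc k) * ((norm (v k))\<^sup>2 - (norm sbar)\<^sup>2)"
        using b \<sigma>_Suc_pos[of k] by (intro mult_left_mono) auto
      also have "\<dots> \<le> B" using B by blast
      finally have "(norm (b (Suc k)))\<^sup>2 \<le> B / \<sigma> (Suc k)"
        using \<sigma>_Suc_pos[of k] by (simp add: field_simps)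
      then show ?thesis by (simp add: real_le_rsqrt flip: real_sqrt_divide)
    qed
    have "norm (norm (b k)) \<le> sqrt B * norm (1 / sqrt (\<Sum>i<k. \<gamma> i))" if "k > 0" for k
      using that bound[of "k - 1"] \<sigma>_Suc_pos[of "k - 1"] by (simp add: \<sigma>_def)
    then show "(\<lambda>k. norm (b k)) \<in> O(\<lambda>k. 1 / sqrt (\<Sum>i<k. \<gamma> i))"
      by (intro bigoI[of _ "sqrt B"] eventually_mono[OF eventually_gt_at_top])
  qed
  have rate_s: "(norm (C (x (Suc k)) - y (Suc k) - sbar))\<^sup>2 \<le> (norm (v k))\<^sup>2 - (norm sbar)\<^sup>2" for k
    using v_excess by (simp add: v_def)
  have s_lim: "(\<lambda>k. C (x k) - y k) \<longlonglongrightarrow> sbar"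
    by (rule LIM_zero_cancel[OF tendsto_norm_zero_cancel[OF conjunct1[OF rate[OF rate_s]]]])
  then have "v \<longlonglongrightarrow> sbar" unfolding v_def[abs_def] by (rule LIMSEQ_Suc)
  \<comment> \<open>Testing the conjugate at \<open>p k\<close> excludes \<open>-\<infinity>\<close>
    and, when the conjugate is finite, supplies the hypothesis \<open>lower\<close>.\<close>
  have h_ge: "ereal (sbar \<bullet> p k - H k) \<le> h_conj sbar" for k
  proof -
    have "neg_dual X K C f (p k) \<le> ereal (H k)"
      using upper by (auto simp: neg_dual_le_iff[of X f, OF not_minf] W_def p_def)
    then have "ereal (sbar \<bullet> p k - H k) \<le> ereal (sbar \<bullet> p k) - neg_dual X K C f (p k)"
      by (metis ereal_minus(1) ereal_minus_mono order_refl)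
    also have "\<dots> \<le> h_conj sbar" unfolding h_conj_def conjugate_def by (rule SUP_upper) simp
    finally show ?thesis .
  qed
  have lower: "sbar \<bullet> p k - c \<le> H k" if "h_conj sbar = ereal c" for c k
    using h_ge[of k] that by simp
  have "(\<lambda>k. ereal (r k)) \<longlonglongrightarrow> h_conj sbar"
  proof (rule order_tendstoI)
    fix b assume "b < h_conj sbar"
    \<comment> \<open>The affine minorant of slope \<open>m\<close> bounds the values from below
      and, as \<open>v\<close> converges to \<open>sbar\<close>, exceeds \<open>b\<close>
      eventually.\<close>
    then obtain m G where m: "neg_dual X K C f m = ereal G" "b < ereal (sbar \<bullet> m - G)"
      using less_conjugate_neg_dual[OF not_minf W_ne[unfolded W_def]] unfolding h_conj_def by metis
    have "(\<lambda>k. ereal (v k \<bullet> m - G)) \<longlonglongrightarrow> ereal (sbar \<bullet> m - G)"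
      by (intro tendsto_intros \<open>v \<longlonglongrightarrow> sbar\<close>)
    then have "\<forall>\<^sub>F k in sequentially. b < ereal (v k \<bullet> m - G)" using m(2) by (rule order_tendstoD)
    moreover have "v k \<bullet> m - G \<le> r k" for k
      using neg_dual_le_iff[of X f K C m G, OF not_minf] m(1) iterate[of k]
      unfolding W_def by (force simp: inner_commute)
    ultimately show "\<forall>\<^sub>F k in sequentially. b < ereal (r k)"
      by (auto elim!: eventually_mono intro: less_le_trans)
  next
    fix b assume b: "h_conj sbar < b"
    \<comment> \<open>Lying strictly below \<open>b\<close> forces the conjugate to be finite, so
      the upper estimate is available; for an infinite conjugate this half is vacuous.\<close>
    then obtain c where c: "h_conj sbar = ereal c" using b h_ge[of 0] by (cases "h_conj sbar") auto
    obtain R where R: "R \<longlonglongrightarrow> c" "\<forall>\<^sub>F k in sequentially. r k \<le> R k"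
      using value_upper_limit[OF lower[OF c]] by blast
    have "(\<lambda>k. ereal (R k)) \<longlonglongrightarrow> ereal c" by (intro tendsto_intros R)
    then have "\<forall>\<^sub>F k in sequentially. ereal (R k) < b" using b c by (intro order_tendstoD) auto
    then show "\<forall>\<^sub>F k in sequentially. ereal (r k) < b"
      using R(2) by eventually_elim (meson ereal_less_eq(3) le_less_trans)
  qed
  then have "(\<lambda>k. f (x (Suc k))) \<longlonglongrightarrow> h_conj sbar" by (simp add: r)
  then have value_lim: "(\<lambda>k. f (x k)) \<longlonglongrightarrow> h_conj sbar" by (rule LIMSEQ_imp_Suc)
  have "\<exists>B. \<forall>k. \<sigma> (Suc k) * ((norm (v k))\<^sup>2 - (norm sbar)\<^sup>2) \<le> B" if finite: "h_conj sbar < \<infinity>"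
  proof -
    obtain c where "h_conj sbar = ereal c" using finite h_ge[of 0] by (cases "h_conj sbar") auto
    then show ?thesis using excess_bound[OF lower] by metis
  qed
  moreover have "h_conj sbar \<noteq> -\<infinity>" using h_ge[of 0] by auto
  ultimately show ?thesis
    using rate[of "\<lambda>k. C (x k) - y k - sbar", OF rate_s]
      rate[of "\<lambda>k. y k - metric_proj K (C (x k))", OF proj_le] s_lim value_lim
    by blast
qed

end
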